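(* Let $K\ge 1$, and let $u^{\{K\}}$ and $U^{\{K\}}$ be the continuum and the discrete global iterates after $K$ iterations of the overlapping additive Schwarz method with $p$ subdomains and Richardson parameter $\tau$, started from the same initial guess, and let $e_D^{\{K\}}=u^{\{K\}}-U^{\{K\}}$. Let $\widetilde U_i^{\{k\}}$ be the local discrete solutions and let $\phi_i^{[k]}\in H^1_0(\Omega_i)$, $1\le k\le K$, $1\le i\le p$, be the solutions of the additive adjoint problems associated with $\psi\in L_2(\Omega)$ (all defined in the context). Then $$\left(\psi, e_D^{\{K\}}\right)=\left(\psi, u^{\{K\}} - U^{\{K\}}\right) = \sum_{k=1}^{K} \sum_{i=1}^p R_i\left(\widetilde{U}^{\{k\}}_i,\ \phi^{[k]}_i - \pi_i \phi^{[k]}_i\right),$$ where $\pi_i v\in V_{i,h,0}$ denotes the approximation of $v\in H^1_0(\Omega_i)$ in $V_{i,h,0}$, and $R_i(s,v)=l_i(v)-a_i(s,v)$.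
   Context: Problem. $\Omega$ is a bounded domain covered by $p$ overlapping open subdomains $\Omega_1,\dots,\Omega_p$: $\cup_i\Omega_i=\Omega$, and for every $i$ there is $j\neq i$ with $\Omega_i\cap\Omega_j\neq\emptyset$. $(\cdot,\cdot)$ and $(\cdot,\cdot)_{ij}$ are the $L_2(\Omega)$ and $L_2(\Omega_i\cap\Omega_j)$ inner products. $a(\cdot,\cdot)$ is the standard bilinear form of a second-order linear elliptic PDE, $a(u,v)=\int_\Omega (A\nabla u\cdot\nabla v+(\mathbf b\cdot\nabla u)v+c\,uv)\,dx$ with bounded measurable coefficients (for Poisson: $\int_\Omega\nabla u\cdot\nabla v\,dx$; no symmetry is assumed), and $l(v)=(f,v)$ with $f\in L_2(\Omega)$. $a_i$, $a_{ij}$ are the restrictions of $a$ (same integrand) to $\Omega_i$ and $\Omega_i\cap\Omega_j$; $l_i$ is the restriction of $l$ to $\Omega_i$. All variational problems below are assumed uniquely solvable. Discretization. $\mathcal T_h$ is a conforming triangulation of $\Omega$ consistent with the decomposition (each $\overline{\Omega}_j$ is a union of elements). $V_h\subset H^1_0(\Omega)$ is a space of continuous piecewise polynomials (of a fixed degree) on $\mathcal T_h$; $V_{i,h,0}\subset H^1_0(\Omega_i)$ is the corresponding space of continuous piecewise polynomials on $\mathcal T_h|_{\Omega_i}$ vanishing on $\partial\Omega_i$. Additive Schwarz. $\tau$ is a real (Richardson) parameter. Start from $u^{\{0\}}=U^{\{0\}}\in V_h$. For $k=0,\dots,K-1$: for each $i=1,\dots,p$, $\widetilde u_i^{\{k+1\}}\in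 H^1(\Omega_i)$ satisfies $\widetilde u_i^{\{k+1\}}=u^{\{k\}}$ on $\partial\Omega_i$ and $a_i(\widetilde u_i^{\{k+1\}},v)=l_i(v)$ for all $v\in H^1_0(\Omega_i)$; then $$u^{\{k+1\}}=(1-\tau p)u^{\{k\}}+\tau\sum_{i=1}^p\Pi_i\widetilde u_i^{\{k+1\}},$$ where $\Pi_i\widetilde u_i^{\{k+1\}}$ equals $\widetilde u_i^{\{k+1\}}$ on $\overline\Omega_i$ and $u^{\{k\}}$ on $\Omega\setminus\overline\Omega_i$. The discrete method is identical: $\widetilde U_i^{\{k+1\}}$ is a continuous piecewise polynomial on $\mathcal T_h|_{\Omega_i}$, equal to $U^{\{k\}}$ on $\partial\Omega_i$, with $a_i(\widetilde U_i^{\{k+1\}},v)=l_i(v)$ for all $v\in V_{i,h,0}$, and $U^{\{k+1\}}\in V_h$ is formed from $U^{\{k\}}$ and the $\widetilde U_i^{\{k+1\}}$ by the same formula. Partition of the data. $\{\chi_i\}_{i=1}^p$ is a partition of unity on $\Omega$ ($\sum_i\chi_i=1$) with $\chi_i=0$ on $\Omega\setminus\Omega_i$, and $\psi_i=\chi_i\psi$, so $\psi_i=0$ on $\Omega\setminus\Omega_i$. (The paper's choice: $\chi_i=d_i/\sum_{j}d_j$ with $d_i(x)=\mathrm{dist}(x,\partial\Omega_i\cap\Omega)$ for $x\in\overline\Omega_i$ and $d_i(x)=0$ otherwise.) Adjoint problems. For $k=K,K-1,\dots,1$ and $i=1,\dots,p$, $\phi_i^{[k]}\in H^1_0(\Omega_i)$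 solves $$a_i\left(v,\phi_i^{[k]}\right)=\tau\sum_{j=1}^p\left\{(\psi_j,v)_{ij}-a_{ij}\left(v,\sum_{l=k+1}^K\phi_j^{[l]}\right)\right\}\quad\forall v\in H^1_0(\Omega_i).$$ *)

theory Defs
  imports "HOL-Analysis.Analysis"
begin

section \<open>Lebesgue and Sobolev spaces on a subset of Euclidean space\<close>

text \<open>Functions on \<open>D\<close> are represented by total functions; values outside the closure
  of \<open>D\<close> never matter. Elements of \<open>L2 D\<close>, \<open>H1 D\<close> and \<open>H10 D\<close> are
  representatives: the spaces are closed under changes on null subsets of \<open>D\<close>.\<close>

definition L2 :: "(real^'n) set \<Rightarrow> (real^'n \<Rightarrow> real) set" where
  "L2 D = {u. u \<in> borel_measurable (lebesgue_on D) \<and> integrable (lebesgue_on D) (\<lambda>x. (u x)\<^sup>2)}"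

definition l2inner :: "(real^'n) set \<Rightarrow> (real^'n \<Rightarrow> real) \<Rightarrow> (real^'n \<Rightarrow> real) \<Rightarrow> real" where
  "l2inner D u v = (LINT x|lebesgue_on D. u x * v x)"

definition pd :: "'n \<Rightarrow> (real^'n \<Rightarrow> real) \<Rightarrow> real^'n \<Rightarrow> real" where
  "pd i f x = frechet_derivative f (at x) (axis i 1)"

primrec Ck :: "nat \<Rightarrow> (real^'n \<Rightarrow> real) \<Rightarrow> bool" where
  "Ck 0 f \<longleftrightarrow> continuous_on UNIV f"
| "Ck (Suc k) f \<longleftrightarrow> (\<forall>x. f differentiable (at x)) \<and> (\<forall>i. Ck k (pd i f))"

definition test_function :: "(real^'n) set \<Rightarrow> (real^'n \<Rightarrow> real) \<Rightarrow> bool" where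
  "test_function D \<theta> \<longleftrightarrow> (\<forall>k. Ck k \<theta>) \<and> (\<exists>S. compact S \<and> S \<subseteq> D \<and> (\<forall>x. x \<notin> S \<longrightarrow> \<theta> x = 0))"

definition has_weak_gradient ::
    "(real^'n) set \<Rightarrow> (real^'n \<Rightarrow> real) \<Rightarrow> (real^'n \<Rightarrow> real^'n) \<Rightarrow> bool" where
  "has_weak_gradient D u g \<longleftrightarrow> (\<forall>i. (\<lambda>x. g x $ i) \<in> L2 D) \<and>
     (\<forall>\<theta>. test_function D \<theta> \<longrightarrow>
        (\<forall>i. (LINT x|lebesgue_on D. u x * pd i \<theta> x) = - (LINT x|lebesgue_on D. g x $ i * \<theta> x)))"

definition H1 :: "(real^'n) set \<Rightarrow> (real^'n \<Rightarrow> real) set" where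
  "H1 D = {u \<in> L2 D. \<exists>g. has_weak_gradient D u g}"

text \<open>On an open set the weak gradient is unique up to null sets; \<open>wgrad\<close> picks a
  representative.\<close>

definition wgrad :: "(real^'n) set \<Rightarrow> (real^'n \<Rightarrow> real) \<Rightarrow> real^'n \<Rightarrow> real^'n" where
  "wgrad D u = (SOME g. has_weak_gradient D u g)"

definition h1norm :: "(real^'n) set \<Rightarrow> (real^'n \<Rightarrow> real) \<Rightarrow> real" where
  "h1norm D u = sqrt ((LINT x|lebesgue_on D. (u x)\<^sup>2) +
                      (LINT x|lebesgue_on D. (norm (wgrad D u x))\<^sup>2))"

definition H10 :: "(real^'n) set \<Rightarrow> (real^'n \<Rightarrow> real) set" where
  "H10 D = {u \<in> H1 D. \<exists>\<theta>. (\<forall>n::nat. test_function D (\<theta> n)) \<and>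
                          (\<lambda>n. h1norm D (\<lambda>x. u x - \<theta> n x)) \<longlonglongrightarrow> 0}"

section \<open>The bilinear form and the residual\<close>

definition elliptic_coefficients ::
    "(real^'n) set \<Rightarrow> (real^'n \<Rightarrow> real^'n^'n) \<Rightarrow> (real^'n \<Rightarrow> real^'n) \<Rightarrow> (real^'n \<Rightarrow> real) \<Rightarrow> bool" where
  "elliptic_coefficients D A b c \<longleftrightarrow>
     A \<in> borel_measurable (lebesgue_on D) \<and> b \<in> borel_measurable (lebesgue_on D) \<and>
     c \<in> borel_measurable (lebesgue_on D) \<and>
     (\<exists>M. AE x in lebesgue_on D. norm (A x) \<le> M \<and> norm (b x) \<le> M \<and> \<bar>c x\<bar> \<le> M) \<and>
     (\<exists>\<alpha>>0. AE x in lebesgue_on D. \<forall>\<xi>. \<alpha> * (norm \<xi>)\<^sup>2 \<le> (A x *v \<xi>) \<bullet> \<xi>)"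

definition bilin ::
    "(real^'n \<Rightarrow> real^'n^'n) \<Rightarrow> (real^'n \<Rightarrow> real^'n) \<Rightarrow> (real^'n \<Rightarrow> real) \<Rightarrow> (real^'n) set \<Rightarrow>
     (real^'n \<Rightarrow> real) \<Rightarrow> (real^'n \<Rightarrow> real) \<Rightarrow> real" where
  "bilin A b c D u v = (LINT x|lebesgue_on D.
     (A x *v wgrad D u x) \<bullet> wgrad D v x + (b x \<bullet> wgrad D u x) * v x + c x * u x * v x)"

definition resid ::
    "(real^'n \<Rightarrow> real^'n^'n) \<Rightarrow> (real^'n \<Rightarrow> real^'n) \<Rightarrow> (real^'n \<Rightarrow> real) \<Rightarrow> (real^'n \<Rightarrow> real) \<Rightarrow>
     (real^'n) set \<Rightarrow> (real^'n \<Rightarrow> real) \<Rightarrow> (real^'n \<Rightarrow> real) \<Rightarrow> real" where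
  "resid A b c f D s v = l2inner D f v - bilin A b c D s v"

section \<open>Overlapping decomposition and finite element spaces\<close>

definition overlapping_decomposition :: "(real^'n) set \<Rightarrow> nat \<Rightarrow> (nat \<Rightarrow> (real^'n) set) \<Rightarrow> bool" where
  "overlapping_decomposition \<Omega> p \<Omega>s \<longleftrightarrow>
     open \<Omega> \<and> connected \<Omega> \<and> bounded \<Omega> \<and> \<Omega> \<noteq> {} \<and>
     (\<forall>i\<in>{1..p}. open (\<Omega>s i)) \<and> (\<Union>i\<in>{1..p}. \<Omega>s i) = \<Omega> \<and>
     (\<forall>i\<in>{1..p}. \<exists>j\<in>{1..p}. j \<noteq> i \<and> \<Omega>s i \<inter> \<Omega>s j \<noteq> {})"

text \<open>Conformity is part of the library notion \<^const>\<open>triangulation\<close>. Elements are closed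
  nondegenerate simplices; requiring their interiors to lie in \<open>D\<close> (and not only in its
  closure) makes the frontier of \<open>D\<close> a subset of the element boundaries.\<close>

definition mesh_of :: "(real^'n) set set \<Rightarrow> (real^'n) set \<Rightarrow> bool" where
  "mesh_of T D \<longleftrightarrow> triangulation T \<and> (\<forall>E\<in>T. int CARD('n) simplex E \<and> interior E \<subseteq> D) \<and>
                  \<Union>T = closure D"

definition restrict_mesh :: "(real^'n) set set \<Rightarrow> (real^'n) set \<Rightarrow> (real^'n) set set" where
  "restrict_mesh T D = {E \<in> T. E \<subseteq> closure D}"

definition poly_deg_le :: "nat \<Rightarrow> (real^'n \<Rightarrow> real) \<Rightarrow> bool" where
  "poly_deg_le q P \<longleftrightarrow> (\<exists>a :: ('n \<Rightarrow> nat) \<Rightarrow> real.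
     \<forall>x. P x = (\<Sum>\<alpha> | sum \<alpha> UNIV \<le> q. a \<alpha> * (\<Prod>i\<in>UNIV. (x $ i) ^ \<alpha> i)))"

definition fe_space ::
    "(real^'n) set set \<Rightarrow> nat \<Rightarrow> (real^'n) set \<Rightarrow> (real^'n \<Rightarrow> real) set" where
  "fe_space T q D = {v. continuous_on (closure D) v \<and>
     (\<forall>E\<in>restrict_mesh T D. \<exists>P. poly_deg_le q P \<and> (\<forall>x\<in>E. v x = P x))}"

definition fe_space0 ::
    "(real^'n) set set \<Rightarrow> nat \<Rightarrow> (real^'n) set \<Rightarrow> (real^'n \<Rightarrow> real) set" where
  "fe_space0 T q D = {v \<in> fe_space T q D \<inter> H10 D. \<forall>x\<in>frontier D. v x = 0}"

section \<open>Additive Schwarz iteration\<close>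

text \<open>\<open>solves_uniquely D Q u\<close>: \<open>u\<close> is the solution on \<open>D\<close> of the problem \<open>Q\<close>,
  unique as an element of \<open>L2 D\<close>.\<close>

definition solves_uniquely ::
    "(real^'n) set \<Rightarrow> ((real^'n \<Rightarrow> real) \<Rightarrow> bool) \<Rightarrow> (real^'n \<Rightarrow> real) \<Rightarrow> bool" where
  "solves_uniquely D Q u \<longleftrightarrow> Q u \<and> (\<forall>w. Q w \<longrightarrow> (AE x in lebesgue_on D. w x = u x))"

text \<open>Dirichlet data \<open>w\<close> on the boundary of \<open>D\<close> are imposed in the trace sense: the
  difference lies in \<open>H10 D\<close>.\<close>

definition local_problem ::
    "(real^'n \<Rightarrow> real^'n^'n) \<Rightarrow> (real^'n \<Rightarrow> real^'n) \<Rightarrow> (real^'n \<Rightarrow> real) \<Rightarrow> (real^'n \<Rightarrow> real) \<Rightarrow>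
     (real^'n) set \<Rightarrow> (real^'n \<Rightarrow> real) \<Rightarrow> (real^'n \<Rightarrow> real) \<Rightarrow> bool" where
  "local_problem A b c f D w ut \<longleftrightarrow>
     ut \<in> H1 D \<and> (\<lambda>x. ut x - w x) \<in> H10 D \<and>
     (\<forall>v\<in>H10 D. bilin A b c D ut v = l2inner D f v)"

definition discrete_local_problem ::
    "(real^'n \<Rightarrow> real^'n^'n) \<Rightarrow> (real^'n \<Rightarrow> real^'n) \<Rightarrow> (real^'n \<Rightarrow> real) \<Rightarrow> (real^'n \<Rightarrow> real) \<Rightarrow>
     (real^'n) set set \<Rightarrow> nat \<Rightarrow> (real^'n) set \<Rightarrow> (real^'n \<Rightarrow> real) \<Rightarrow> (real^'n \<Rightarrow> real) \<Rightarrow> bool" where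
  "discrete_local_problem A b c f T q D W Ut \<longleftrightarrow>
     Ut \<in> fe_space T q D \<and> (\<lambda>x. Ut x - W x) \<in> fe_space0 T q D \<and>
     (\<forall>v\<in>fe_space0 T q D. bilin A b c D Ut v = l2inner D f v)"

definition patch ::
    "(real^'n) set \<Rightarrow> (real^'n \<Rightarrow> real) \<Rightarrow> (real^'n \<Rightarrow> real) \<Rightarrow> real^'n \<Rightarrow> real" where
  "patch D ut u x = (if x \<in> closure D then ut x else u x)"

definition schwarz_update ::
    "real \<Rightarrow> nat \<Rightarrow> (nat \<Rightarrow> (real^'n) set) \<Rightarrow> (real^'n \<Rightarrow> real) \<Rightarrow> (nat \<Rightarrow> real^'n \<Rightarrow> real) \<Rightarrow>
     real^'n \<Rightarrow> real" where
  "schwarz_update \<tau> p \<Omega>s u ut x =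
     (1 - \<tau> * real p) * u x + \<tau> * (\<Sum>i=1..p. patch (\<Omega>s i) (ut i) u x)"

text \<open>The indices of \<open>ut k i\<close>, \<open>Ut k i\<close> and \<open>\<phi> k i\<close> are iteration first, then subdomain.
  Continuum iterates are determined up to null sets, discrete ones pointwise on the closed
  domain.\<close>

definition continuum_schwarz ::
    "(real^'n \<Rightarrow> real^'n^'n) \<Rightarrow> (real^'n \<Rightarrow> real^'n) \<Rightarrow> (real^'n \<Rightarrow> real) \<Rightarrow> (real^'n \<Rightarrow> real) \<Rightarrow>
     (real^'n) set \<Rightarrow> nat \<Rightarrow> (nat \<Rightarrow> (real^'n) set) \<Rightarrow> real \<Rightarrow> nat \<Rightarrow>
     (nat \<Rightarrow> real^'n \<Rightarrow> real) \<Rightarrow> (nat \<Rightarrow> nat \<Rightarrow> real^'n \<Rightarrow> real) \<Rightarrow> bool" where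
  "continuum_schwarz A b c f \<Omega> p \<Omega>s \<tau> K u ut \<longleftrightarrow>
     (\<forall>k<K. (\<forall>i\<in>{1..p}. solves_uniquely (\<Omega>s i)
                          (local_problem A b c f (\<Omega>s i) (u k)) (ut (Suc k) i)) \<and>
            (AE x in lebesgue_on \<Omega>. u (Suc k) x = schwarz_update \<tau> p \<Omega>s (u k) (ut (Suc k)) x))"

definition discrete_schwarz ::
    "(real^'n \<Rightarrow> real^'n^'n) \<Rightarrow> (real^'n \<Rightarrow> real^'n) \<Rightarrow> (real^'n \<Rightarrow> real) \<Rightarrow> (real^'n \<Rightarrow> real) \<Rightarrow>
     (real^'n) set set \<Rightarrow> nat \<Rightarrow> (real^'n) set \<Rightarrow> nat \<Rightarrow> (nat \<Rightarrow> (real^'n) set) \<Rightarrow> real \<Rightarrow> nat \<Rightarrow>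
     (nat \<Rightarrow> real^'n \<Rightarrow> real) \<Rightarrow> (nat \<Rightarrow> nat \<Rightarrow> real^'n \<Rightarrow> real) \<Rightarrow> bool" where
  "discrete_schwarz A b c f T q \<Omega> p \<Omega>s \<tau> K U Ut \<longleftrightarrow>
     (\<forall>k<K. (\<forall>i\<in>{1..p}. solves_uniquely (\<Omega>s i)
                          (discrete_local_problem A b c f T q (\<Omega>s i) (U k)) (Ut (Suc k) i)) \<and>
            (\<forall>x\<in>closure \<Omega>. U (Suc k) x = schwarz_update \<tau> p \<Omega>s (U k) (Ut (Suc k)) x))"

section \<open>Adjoint problems\<close>

definition data_partition ::
    "(real^'n) set \<Rightarrow> nat \<Rightarrow> (nat \<Rightarrow> (real^'n) set) \<Rightarrow> (nat \<Rightarrow> real^'n \<Rightarrow> real) \<Rightarrow> bool" where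
  "data_partition \<Omega> p \<Omega>s \<rho> \<longleftrightarrow>
     (\<forall>i\<in>{1..p}. \<rho> i \<in> borel_measurable (lebesgue_on \<Omega>) \<and> (\<forall>x\<in>\<Omega>. 0 \<le> \<rho> i x) \<and>
                 (\<forall>x\<in>\<Omega> - \<Omega>s i. \<rho> i x = 0)) \<and>
     (\<forall>x\<in>\<Omega>. (\<Sum>i=1..p. \<rho> i x) = 1)"

text \<open>The problem defining the unknown \<open>g = \<phi> k i\<close> in terms of the \<open>\<phi> l j\<close> with \<open>l > k\<close>.\<close>

definition adjoint_problem ::
    "(real^'n \<Rightarrow> real^'n^'n) \<Rightarrow> (real^'n \<Rightarrow> real^'n) \<Rightarrow> (real^'n \<Rightarrow> real) \<Rightarrow>
     nat \<Rightarrow> (nat \<Rightarrow> (real^'n) set) \<Rightarrow> real \<Rightarrow> nat \<Rightarrow> (nat \<Rightarrow> real^'n \<Rightarrow> real) \<Rightarrow>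
     (nat \<Rightarrow> nat \<Rightarrow> real^'n \<Rightarrow> real) \<Rightarrow> nat \<Rightarrow> nat \<Rightarrow> (real^'n \<Rightarrow> real) \<Rightarrow> bool" where
  "adjoint_problem A b c p \<Omega>s \<tau> K \<psi>s \<phi> k i g \<longleftrightarrow>
     g \<in> H10 (\<Omega>s i) \<and>
     (\<forall>v\<in>H10 (\<Omega>s i). bilin A b c (\<Omega>s i) v g =
        \<tau> * (\<Sum>j=1..p. l2inner (\<Omega>s i \<inter> \<Omega>s j) (\<psi>s j) v
                     - bilin A b c (\<Omega>s i \<inter> \<Omega>s j) v (\<lambda>x. \<Sum>l=k+1..K. \<phi> l j x)))"

end

theory Submission
  imports Defs
begin

text \<open>
  Write \<open>w\<^sub>i\<close> for the correction that subdomain \<open>i\<close> contributes in one sweep, the local solution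
  minus the previous iterate. It vanishes on the boundary of the subdomain, so it can be extended
  by zero, and a sweep adds \<open>\<tau>\<close> times the sum of the extended corrections. Hence the error after
  \<open>K\<close> sweeps is \<open>\<tau>\<close> times the sum, over all sweeps \<open>k\<close> and subdomains \<open>i\<close>, of the zero extensions of
  the correction errors \<open>z k i\<close> (continuum minus discrete).

  Galerkin orthogonality removes the projection from the residual, and the weak form of the
  continuum problem turns what remains into \<open>a\<^sub>i(e, \<phi> k i) + a\<^sub>i(z k i, \<phi> k i)\<close>, where \<open>e\<close> is the error
  before sweep \<open>k\<close>. The second term is the left-hand side of the adjoint problem tested with
  \<open>z k i\<close>. It yields \<open>\<tau>\<close> times the pairing of \<open>\<psi>\<close> with \<open>z k i\<close>, minus terms in which \<open>z k i\<close> meets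
  the adjoint solutions of later sweeps on the overlaps. Expanding \<open>e\<close> in the first term gives exactly the same
  terms, sorted by the later sweep instead of the earlier one. The double sums cancel by
  exchanging the order of summation over \<open>m < k\<close> (\<open>sum_triangle_swap\<close>), and the pairings with
  \<open>\<psi>\<close> add up to the pairing with the error.

  The analytic content lies in three facts that make this bookkeeping legitimate.
  Weak gradients on open sets are unique almost everywhere (\<open>has_weak_gradient_unique\<close>), so that the bilinear
  form can be evaluated with any of them and is bilinear. The zero extension of a function in
  \<open>H10\<close> has the zero extension of the gradient as its weak gradient (\<open>H10_zext\<close>), so that a form on one subdomain sees
  the correction of another one only on the overlap (\<open>bilin_zext_left\<close>). Finally, boundaries of subdomains are null sets
  because they are covered by the faces of finitely many simplices (\<open>mesh_frontier_null\<close>), so that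
  the values taken by the updated function there do not matter.
\<close>

section \<open>Smooth bump functions\<close>

text \<open>The factor \<open>1 / t ^ r\<close> makes the family closed under differentiation; the functions with
  \<open>r = 0\<close> are the usual smooth transitions from \<open>0\<close>.\<close>

definition flat_exp :: "real \<Rightarrow> nat \<Rightarrow> real \<Rightarrow> real" where
  "flat_exp m r t = (if t > 0 then exp (- m * inverse t) * inverse t ^ r else 0)"

lemma flat_exp_tendsto_0:
  assumes "m > 0" shows "(flat_exp m r \<longlongrightarrow> 0) (at 0)"
proof -
  have eq: "inverse (m ^ r) * ((s * m) ^ r / exp (s * m)) = s ^ r / exp (s * m)" for s
    using assms by (simp add: power_mult_distrib)
  have "((\<lambda>s::real. inverse (m ^ r) * ((s * m) ^ r / exp (s * m))) \<longlongrightarrow> inverse (m ^ r) * 0) at_top"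
    using assms by (intro tendsto_mult tendsto_const filterlim_compose[OF tendsto_power_div_exp_0]
      filterlim_at_top_mult_tendsto_pos[OF tendsto_const] filterlim_ident)
  then have "((\<lambda>s::real. s ^ r / exp (s * m)) \<longlongrightarrow> 0) at_top"
    by (simp only: eq mult_zero_right)
  then have "((\<lambda>t::real. (inverse t) ^ r / exp (inverse t * m)) \<longlongrightarrow> 0) (at_right 0)"
    by (rule filterlim_compose) (rule filterlim_inverse_at_top_right)
  then have "(flat_exp m r \<longlongrightarrow> 0) (at_right 0)"
    by (rule Lim_transform_eventually)
       (auto simp: flat_exp_def eventually_at_filter exp_minus divide_inverse ac_simps intro!: always_eventually)
  moreover have "(flat_exp m r \<longlongrightarrow> 0) (at_left 0)"
    by (rule Lim_transform_eventually[OF tendsto_const])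
       (auto simp: flat_exp_def eventually_at_filter intro!: always_eventually)
  ultimately show ?thesis by (simp add: filterlim_split_at)
qed

lemma flat_exp_has_derivative:
  assumes "m > 0"
  shows "(flat_exp m r has_real_derivative (m * flat_exp m (r+2) t - real r * flat_exp m (r+1) t)) (at t)"
proof -
  consider "t > 0" | "t < 0" | "t = 0" by linarith
  then show ?thesis
  proof cases
    case 1
    have r: "real r * inverse t ^ (r - Suc 0) * (inverse t * inverse t) = real r * inverse t ^ (r + 1)"
      by (cases r) auto
    have "((\<lambda>t. exp (- m * inverse t) * inverse t ^ r) has_real_derivative
        (exp (- m * inverse t) * (- m * - (inverse t * inverse t))) * inverse t ^ r
         + real r * inverse t ^ (r - Suc 0) * - (inverse t * inverse t) * exp (- m * inverse t)) (at t)"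
      using 1 by (auto intro!: derivative_eq_intros simp: power2_eq_square)
    also have "(exp (- m * inverse t) * (- m * - (inverse t * inverse t))) * inverse t ^ r
         + real r * inverse t ^ (r - Suc 0) * - (inverse t * inverse t) * exp (- m * inverse t)
       = m * flat_exp m (r+2) t - (real r * inverse t ^ (r - Suc 0) * (inverse t * inverse t)) * exp (- m * inverse t)"
      using 1 by (simp add: flat_exp_def)
    also have "\<dots> = m * flat_exp m (r+2) t - real r * flat_exp m (r+1) t"
      unfolding r using 1 by (simp add: flat_exp_def)
    finally have "((\<lambda>t. exp (- m * inverse t) * inverse t ^ r) has_real_derivative
        (m * flat_exp m (r+2) t - real r * flat_exp m (r+1) t)) (at t)" .
    then show ?thesis
      by (rule has_field_derivative_transform_within_open[where S="{0<..}"])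
         (use 1 in \<open>auto simp: flat_exp_def\<close>)
  next
    case 2
    have "((\<lambda>t. 0) has_real_derivative (m * flat_exp m (r+2) t - real r * flat_exp m (r+1) t)) (at t)"
      using 2 by (auto simp: flat_exp_def)
    then show ?thesis
      by (rule has_field_derivative_transform_within_open[where S="{..<0}"])
         (use 2 in \<open>auto simp: flat_exp_def\<close>)
  next
    case 3
    have "((\<lambda>h. (flat_exp m r (0 + h) - flat_exp m r 0) / h) \<longlongrightarrow> 0) (at 0)"
      by (rule Lim_transform_eventually[OF flat_exp_tendsto_0[OF assms, of "r+1"]])
         (auto simp: flat_exp_def eventually_at_filter divide_inverse intro!: always_eventually)
    then show ?thesis using 3 by (simp add: DERIV_def flat_exp_def)
  qed
qed

lemma pd_eq_derivative_axis:
  assumes "(f has_derivative f') (at x)" shows "pd i f x = f' (axis i 1)"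
  using frechet_derivative_at[OF assms] by (simp add: pd_def)

text \<open>Membership in an algebra that is closed under partial derivatives yields differentiability of
  every order without computing any higher derivative.\<close>

inductive flat_algebra :: "real \<Rightarrow> (real^'n \<Rightarrow> real) \<Rightarrow> bool" for m where
  const: "flat_algebra m (\<lambda>x. c)"
| flat: "flat_algebra m (\<lambda>x. flat_exp m r (s * x $ j + c))"
| add: "flat_algebra m f \<Longrightarrow> flat_algebra m g \<Longrightarrow> flat_algebra m (\<lambda>x. f x + g x)"
| mult: "flat_algebra m f \<Longrightarrow> flat_algebra m g \<Longrightarrow> flat_algebra m (\<lambda>x. f x * g x)"

lemma flat_algebra_differentiable:
  fixes f :: "real^'n \<Rightarrow> real"
  assumes "flat_algebra m f" and m: "m > 0"
  shows "(\<forall>x. f differentiable (at x)) \<and> (\<forall>i. flat_algebra m (pd i f))"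
  using assms(1)
proof induction
  case (const c)
  have "pd i (\<lambda>x. c) = (\<lambda>x. 0)" for i :: 'n
    by (rule ext) (simp add: pd_eq_derivative_axis[OF has_derivative_const])
  then show ?case by (auto intro: flat_algebra.const)
next
  case (flat r s j c)
  let ?d = "\<lambda>t. m * flat_exp m (r+2) t + (- real r) * flat_exp m (r+1) t"
  have D: "((\<lambda>x::real^'n. flat_exp m r (s * x $ j + c)) has_derivative
             (\<lambda>h. ?d (s * x $ j + c) * (s * h $ j))) (at x)" for x :: "real^'n"
  proof -
    have 1: "((\<lambda>x::real^'n. s * x $ j + c) has_derivative (\<lambda>h. s * h $ j)) (at x)"
      by (auto intro!: derivative_eq_intros bounded_linear.has_derivative[OF bounded_linear_vec_nth])
    have 2: "(flat_exp m r has_derivative (\<lambda>h. ?d (s * x $ j + c) * h)) (at (s * x $ j + c))"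
      using flat_exp_has_derivative[OF m, of r "s * x $ j + c"]
      by (simp add: has_field_derivative_def)
    show ?thesis using has_derivative_compose[OF 1 2] by simp
  qed
  have "pd i (\<lambda>x::real^'n. flat_exp m r (s * x $ j + c)) =
     (\<lambda>x. (if i = j then s else 0) * (m * flat_exp m (r+2) (s * x $ j + c) + (- real r) * flat_exp m (r+1) (s * x $ j + c)))" for i
    by (rule ext) (simp add: pd_eq_derivative_axis[OF D] axis_def)
  moreover have "flat_algebra m (\<lambda>x. K * (m * flat_exp m (r+2) (s * x $ j + c) + (- real r) * flat_exp m (r+1) (s * x $ j + c)))" for K
    by (intro flat_algebra.add flat_algebra.mult flat_algebra.flat flat_algebra.const)
  ultimately have "flat_algebra m (pd i (\<lambda>x::real^'n. flat_exp m r (s * x $ j + c)))" for i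
    by simp
  moreover have "(\<lambda>x::real^'n. flat_exp m r (s * x $ j + c)) differentiable (at x)" for x
    by (rule differentiableI[OF D])
  ultimately show ?case by simp
next
  case (add f g)
  have D: "((\<lambda>x. f x + g x) has_derivative (\<lambda>h. frechet_derivative f (at x) h + frechet_derivative g (at x) h)) (at x)" for x
    using add by (intro has_derivative_add) (auto simp: frechet_derivative_works)
  have "pd i (\<lambda>x. f x + g x) = (\<lambda>x. pd i f x + pd i g x)" for i
    by (rule ext) (simp add: pd_eq_derivative_axis[OF D] pd_def)
  then show ?case using D add by (auto simp: differentiable_def intro!: flat_algebra.add)
next
  case (mult f g)
  have D: "((\<lambda>x. f x * g x) has_derivative (\<lambda>h. f x * frechet_derivative g (at x) h + frechet_derivative f (at x) h * g x)) (at x)" for x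
    using mult by (intro has_derivative_mult) (auto simp: frechet_derivative_works)
  have "pd i (\<lambda>x. f x * g x) = (\<lambda>x. f x * pd i g x + pd i f x * g x)" for i
    by (rule ext) (simp add: pd_eq_derivative_axis[OF D] pd_def)
  then show ?case using D mult by (auto simp: differentiable_def intro!: flat_algebra.add flat_algebra.mult)
qed

lemma flat_algebra_Ck:
  assumes "m > 0" "flat_algebra m f"
  shows "Ck k f"
  using assms(2)
proof (induction k arbitrary: f)
  case 0
  then show ?case using flat_algebra_differentiable[OF 0 assms(1)]
    by (auto simp: continuous_on_eq_continuous_at differentiable_imp_continuous_within)
next
  case (Suc k)
  then show ?case using flat_algebra_differentiable[OF Suc.prems assms(1)] by auto
qed

lemma flat_algebra_prod:
  "finite I \<Longrightarrow> (\<And>i. i \<in> I \<Longrightarrow> flat_algebra m (f i)) \<Longrightarrow> flat_algebra m (\<lambda>x. \<Prod>i\<in>I. f i x)"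
  by (induction I rule: finite_induct) (auto intro: flat_algebra.const flat_algebra.mult)

text \<open>Unlike a mollifier, this function keeps the open box as the set where it is positive while
  \<open>n\<close> grows, and tends to \<open>1\<close> there. So the indicator of a box is a bounded pointwise limit of test functions.\<close>

definition bump :: "real^'n \<Rightarrow> real^'n \<Rightarrow> nat \<Rightarrow> real^'n \<Rightarrow> real" where
  "bump a b n x = (\<Prod>i\<in>UNIV. flat_exp (1 / Suc n) 0 (x $ i - a $ i) * flat_exp (1 / Suc n) 0 (b $ i - x $ i))"

lemma test_function_bump:
  assumes "cbox a b \<subseteq> D" shows "test_function D (bump a b n)"
proof -
  have "flat_algebra (1 / Suc n) (\<lambda>x. \<Prod>i\<in>UNIV. flat_exp (1 / Suc n) 0 (1 * x $ i + (- a $ i)) * flat_exp (1 / Suc n) 0 ((-1) * x $ i + b $ i))"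
    by (intro flat_algebra_prod flat_algebra.mult flat_algebra.flat) auto
  then have "flat_algebra (1 / Suc n) (bump a b n)"
    by (simp add: bump_def[abs_def] add.commute[of _ "b $ _"])
  then have "Ck k (bump a b n)" for k by (rule flat_algebra_Ck[rotated]) simp
  moreover have "bump a b n x = 0" if "x \<notin> cbox a b" for x
  proof -
    obtain i where "\<not> (a $ i \<le> x $ i \<and> x $ i \<le> b $ i)" using \<open>x \<notin> cbox a b\<close> by (auto simp: mem_box_cart)
    then have "flat_exp (1 / Suc n) 0 (x $ i - a $ i) * flat_exp (1 / Suc n) 0 (b $ i - x $ i) = 0"
      by (auto simp: flat_exp_def)
    then show ?thesis unfolding bump_def by (intro prod_zero) auto
  qed
  ultimately show ?thesis
    unfolding test_function_def by (intro conjI allI exI[of _ "cbox a b"] compact_cbox assms) auto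
qed

lemma bump_bounds: "0 \<le> bump a b n x" "bump a b n x \<le> 1"
proof -
  have f: "0 \<le> flat_exp (1 / Suc n) 0 t" "flat_exp (1 / Suc n) 0 t \<le> 1" for t by (auto simp: flat_exp_def)
  show "0 \<le> bump a b n x" unfolding bump_def by (intro prod_nonneg ballI mult_nonneg_nonneg f)
  show "bump a b n x \<le> 1" unfolding bump_def by (intro prod_le_1 conjI mult_nonneg_nonneg mult_le_one f)
qed

lemma bump_tendsto_indicator: "(\<lambda>n. bump a b n x) \<longlonglongrightarrow> indicator (box a b) x"
proof -
  have f: "(\<lambda>n. flat_exp (1 / Suc n) 0 t) \<longlonglongrightarrow> (if t > 0 then 1 else 0)" for t
  proof (cases "t > 0")
    case True
    have "(\<lambda>n. exp (- inverse (real (Suc n)) * inverse t)) \<longlonglongrightarrow> exp (- 0 * inverse t)"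
      by (intro tendsto_intros LIMSEQ_inverse_real_of_nat)
    then show ?thesis using True by (simp add: flat_exp_def divide_inverse)
  qed (simp add: flat_exp_def)
  have "(\<lambda>n. bump a b n x) \<longlonglongrightarrow>
      (\<Prod>i\<in>UNIV. (if x $ i - a $ i > 0 then 1 else 0) * (if b $ i - x $ i > 0 then 1 else 0))"
    unfolding bump_def by (intro tendsto_prod tendsto_mult f)
  also have "(\<Prod>i\<in>UNIV. (if x $ i - a $ i > 0 then 1 else 0) * (if b $ i - x $ i > 0 then 1 else (0::real)))
     = indicator (box a b) x"
  proof (cases "x \<in> box a b")
    case False
    then obtain i where "\<not> (a $ i < x $ i \<and> x $ i < b $ i)" by (auto simp: mem_box_cart)
    then have "(if x $ i - a $ i > 0 then 1 else 0) * (if b $ i - x $ i > 0 then 1 else (0::real)) = 0" by auto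
    then have "(\<Prod>i\<in>UNIV. (if x $ i - a $ i > 0 then 1 else 0) * (if b $ i - x $ i > 0 then 1 else (0::real))) = 0"
      by (intro prod_zero bexI[of _ i]) simp_all
    then show ?thesis using False by simp
  qed (auto simp: mem_box_cart)
  finally show ?thesis .
qed

section \<open>Integration by parts for test functions\<close>

lemma has_derivative_pd_line:
  assumes "f differentiable (at (x + t *\<^sub>R axis i 1))"
  shows "((\<lambda>s. f (x + s *\<^sub>R axis i 1)) has_real_derivative pd i f (x + t *\<^sub>R axis i 1)) (at t)"
proof -
  have 1: "((\<lambda>s. x + s *\<^sub>R axis i 1) has_derivative (\<lambda>s. s *\<^sub>R axis i 1)) (at t)"
    by (auto intro!: derivative_eq_intros)
  have 2: "(f has_derivative frechet_derivative f (at (x + t *\<^sub>R axis i 1))) (at (x + t *\<^sub>R axis i 1))"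
    using assms by (simp add: frechet_derivative_works)
  have "((\<lambda>s. f (x + s *\<^sub>R axis i 1)) has_derivative
     (\<lambda>s. frechet_derivative f (at (x + t *\<^sub>R axis i 1)) (s *\<^sub>R axis i 1))) (at t)"
    using has_derivative_compose[OF 1 2] .
  then show ?thesis
    unfolding has_field_derivative_def pd_def
    using linear_scale[OF linear_frechet_derivative[OF assms]] by (simp add: mult_commute_abs)
qed

lemma pd_diff:
  assumes "f differentiable (at x)" "g differentiable (at x)"
  shows "pd i (\<lambda>x. f x - g x) x = pd i f x - pd i g x"
  using pd_eq_derivative_axis[OF has_derivative_diff[OF assms[unfolded frechet_derivative_works]]]
  by (simp add: pd_def)

lemma pd_mult:
  assumes "f differentiable (at x)" "g differentiable (at x)"
  shows "pd i (\<lambda>x. f x * g x) x = f x * pd i g x + pd i f x * g x"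
  using pd_eq_derivative_axis[OF has_derivative_mult[OF assms[unfolded frechet_derivative_works]]]
  by (simp add: pd_def)

lemma pd_eq_0_outside:
  assumes "closed S" "\<And>x. x \<notin> S \<Longrightarrow> f x = 0" "x \<notin> S" shows "pd i f x = 0"
proof -
  have "(f has_derivative (\<lambda>h. 0)) (at x)"
    by (rule has_derivative_transform_within_open[where f="\<lambda>x. 0" and s="-S"]) (use assms in auto)
  then show ?thesis by (simp add: pd_eq_derivative_axis)
qed

lemma Ck_diff: "Ck k f \<Longrightarrow> Ck k g \<Longrightarrow> Ck k (\<lambda>x. f x - g x)"
proof (induction k arbitrary: f g)
  case 0
  then show ?case by (auto intro: continuous_intros)
next
  case (Suc k)
  have "pd i (\<lambda>x. f x - g x) = (\<lambda>x. pd i f x - pd i g x)" for i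
    using Suc.prems by (intro ext pd_diff) auto
  then show ?case using Suc by auto
qed

lemma test_function_diff:
  assumes "test_function D f" "test_function D g" shows "test_function D (\<lambda>x. f x - g x)"
proof -
  obtain S S' where "compact S" "S \<subseteq> D" "\<forall>x. x \<notin> S \<longrightarrow> f x = 0" "compact S'" "S' \<subseteq> D" "\<forall>x. x \<notin> S' \<longrightarrow> g x = 0"
    using assms unfolding test_function_def by blast
  then have "compact (S \<union> S') \<and> S \<union> S' \<subseteq> D \<and> (\<forall>x. x \<notin> S \<union> S' \<longrightarrow> f x - g x = 0)" by auto
  then show ?thesis using assms Ck_diff unfolding test_function_def by blast
qed

lemma test_function_mono: "test_function D f \<Longrightarrow> D \<subseteq> D' \<Longrightarrow> test_function D' f"
  unfolding test_function_def by blast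

lemma test_function_pd:
  assumes "test_function D f" shows "test_function D (pd i f)"
proof -
  obtain S where S: "compact S" "S \<subseteq> D" "\<And>x. x \<notin> S \<Longrightarrow> f x = 0"
    using assms unfolding test_function_def by blast
  have "Ck k (pd i f)" for k
    using assms unfolding test_function_def by (metis Ck.simps(2))
  moreover have "\<forall>x. x \<notin> S \<longrightarrow> pd i f x = 0"
    by (intro allI impI pd_eq_0_outside[OF compact_imp_closed[OF S(1)]]) (auto intro: S(3))
  ultimately show ?thesis using S unfolding test_function_def by blast
qed

lemma test_function_differentiable: "test_function D f \<Longrightarrow> f differentiable (at x)"
  unfolding test_function_def by (metis Ck.simps(2))

lemma test_function_continuous: "test_function D f \<Longrightarrow> continuous_on UNIV f"
  unfolding test_function_def by (metis Ck.simps(1))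

lemma test_function_outside: "test_function D f \<Longrightarrow> x \<notin> D \<Longrightarrow> f x = 0"
  unfolding test_function_def by blast

lemma test_function_borel: "test_function D f \<Longrightarrow> f \<in> borel_measurable borel"
  using borel_measurable_continuous_onI test_function_continuous by blast

lemma bounded_of_compact_support:
  fixes f :: "real^'n \<Rightarrow> real"
  assumes "continuous_on UNIV f" "compact S" "\<And>x. x \<notin> S \<Longrightarrow> f x = 0"
  obtains B where "B \<ge> 0" "\<And>x. \<bar>f x\<bar> \<le> B"
proof -
  have "bounded (f ` S)"
    using assms by (intro compact_imp_bounded compact_continuous_image continuous_on_subset[OF assms(1)]) auto
  then obtain B where B: "\<And>x. x \<in> S \<Longrightarrow> \<bar>f x\<bar> \<le> B" unfolding bounded_iff by auto
  show ?thesis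
  proof (rule that[of "max B 0"])
    show "\<bar>f x\<bar> \<le> max B 0" for x using B[of x] assms(3)[of x] by (cases "x \<in> S") auto
  qed simp
qed

lemma integrable_of_compact_support:
  fixes f :: "real^'n \<Rightarrow> real"
  assumes f: "continuous_on UNIV f" "compact S" "\<And>x. x \<notin> S \<Longrightarrow> f x = 0"
  shows "integrable lborel f"
proof -
  obtain B where B: "B \<ge> 0" "\<And>x. \<bar>f x\<bar> \<le> B" using bounded_of_compact_support[OF f] by blast
  show ?thesis
  proof (rule Bochner_Integration.integrable_bound)
    show "integrable lborel (\<lambda>x. B * indicator S x)"
      using emeasure_compact_finite[OF f(2)] f(2) by (auto intro!: integrable_mult_right integrable_real_indicator simp: borel_compact)
    show "f \<in> borel_measurable lborel" using borel_measurable_continuous_onI[OF f(1)] by simp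
    show "AE x in lborel. norm (f x) \<le> norm (B * indicator S x)"
      using B f(3) by (auto simp: indicator_def)
  qed
qed

text \<open>The difference quotients in the coordinate direction have integral \<open>0\<close> by translation invariance
  of Lebesgue measure, and they converge boundedly to the partial derivative.\<close>

lemma integral_pd_eq_0:
  fixes F :: "real^'n \<Rightarrow> real"
  assumes diff: "\<And>x. F differentiable (at x)" and cont: "continuous_on UNIV (pd i F)"
    and S: "compact S" "\<And>x. x \<notin> S \<Longrightarrow> F x = 0"
  shows "(LINT x|lborel. pd i F x) = 0"
proof -
  let ?e = "axis i 1 :: real^'n"
  define t :: "nat \<Rightarrow> real" where "t n = inverse (Suc n)" for n
  have t: "0 < t n" "t n \<le> 1" for n by (auto simp: t_def field_simps)
  have t0: "t \<longlonglongrightarrow> 0" unfolding t_def by (rule LIMSEQ_inverse_real_of_nat)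
  define Q where "Q n x = (F (x + t n *\<^sub>R ?e) - F x) / t n" for n x
  have contF: "continuous_on UNIV F"
    using diff by (simp add: continuous_on_eq_continuous_at differentiable_imp_continuous_within)
  have pd0: "pd i F x = 0" if "x \<notin> S" for x
    using pd_eq_0_outside[OF compact_imp_closed[OF S(1)] S(2) that] .
  obtain B where B: "B \<ge> 0" "\<And>x. \<bar>pd i F x\<bar> \<le> B"
    using bounded_of_compact_support[OF cont S(1) pd0] by blast
  obtain R where R: "\<And>x. x \<in> S \<Longrightarrow> norm x \<le> R"
    using compact_imp_bounded[OF S(1)] unfolding bounded_iff by blast
  have line: "((\<lambda>s. F (x + s *\<^sub>R ?e)) has_real_derivative pd i F (x + s *\<^sub>R ?e)) (at s)" for x s
    by (rule has_derivative_pd_line[OF diff])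
  have Q: "(\<lambda>n. Q n x) \<longlonglongrightarrow> pd i F x" for x
  proof -
    have "((\<lambda>h. (F (x + (0 + h) *\<^sub>R ?e) - F (x + 0 *\<^sub>R ?e)) / h) \<longlongrightarrow> pd i F (x + 0 *\<^sub>R ?e)) (at 0)"
      using line[of x 0] unfolding DERIV_def .
    moreover have "filterlim t (at 0) sequentially"
      using t0 t(1) by (auto simp: filterlim_at intro!: always_eventually) (metis less_irrefl)
    ultimately show ?thesis
      unfolding Q_def by (auto dest: filterlim_compose)
  qed
  have Qb: "\<bar>Q n x\<bar> \<le> B * indicator (cball 0 (R + 1)) x" for n x
  proof (cases "norm x \<le> R + 1")
    case True
    obtain z where "F (x + t n *\<^sub>R ?e) - F (x + 0 *\<^sub>R ?e) = (t n - 0) * pd i F (x + z *\<^sub>R ?e)"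
      using MVT2[of 0 "t n" "\<lambda>s. F (x + s *\<^sub>R ?e)" "\<lambda>s. pd i F (x + s *\<^sub>R ?e)"] line t(1) by blast
    then have "Q n x = pd i F (x + z *\<^sub>R ?e)" using t(1)[of n] by (simp add: Q_def)
    then show ?thesis using B True by (simp add: dist_norm)
  next
    case False
    have "norm x \<le> norm (x + t n *\<^sub>R ?e) + norm (t n *\<^sub>R ?e)"
      by (metis add_diff_cancel norm_triangle_ineq4)
    also have "norm (t n *\<^sub>R ?e) \<le> 1" using t[of n] by simp
    finally have "x + t n *\<^sub>R ?e \<notin> S" "x \<notin> S" using R False by fastforce+
    then show ?thesis using S(2) B by (simp add: Q_def)
  qed
  have int: "integrable lborel F" by (rule integrable_of_compact_support[OF contF S])
  have int': "integrable lborel (\<lambda>x. F (x + c))" "(LINT x|lborel. F (x + c)) = (LINT x|lborel. F x)" for c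
  proof -
    have "integrable (distr lborel borel ((+) c)) F" using int by (simp add: lborel_distr_plus)
    then show "integrable lborel (\<lambda>x. F (x + c))"
      by (subst (asm) integrable_distr_eq) (auto simp: add.commute borel_measurable_continuous_onI contF)
    have "(LINT x|distr lborel borel ((+) c). F x) = (LINT x|lborel. F (c + x))"
      by (rule integral_distr) (auto simp: borel_measurable_continuous_onI contF)
    then show "(LINT x|lborel. F (x + c)) = (LINT x|lborel. F x)"
      by (simp add: lborel_distr_plus add.commute)
  qed
  have "(\<lambda>n. LINT x|lborel. Q n x) \<longlonglongrightarrow> (LINT x|lborel. pd i F x)"
  proof (rule integral_dominated_convergence)
    show "pd i F \<in> borel_measurable lborel" using borel_measurable_continuous_onI[OF cont] by simp
    show "Q n \<in> borel_measurable lborel" for n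
      unfolding Q_def using int int' by (intro borel_measurable_integrable integrable_divide_zero Bochner_Integration.integrable_diff) auto
    show "integrable lborel (\<lambda>x. B * indicator (cball 0 (R + 1)) x)"
      using emeasure_compact_finite[OF compact_cball, of 0 "R + 1"]
      by (intro integrable_mult_right integrable_real_indicator) auto
  qed (use Q Qb in auto)
  moreover have "(LINT x|lborel. Q n x) = 0" for n
    unfolding Q_def using int int' by simp
  ultimately show ?thesis by (simp add: LIMSEQ_const_iff)
qed

lemma integration_by_parts:
  fixes \<theta> \<eta> :: "real^'n \<Rightarrow> real"
  assumes \<theta>: "test_function D \<theta>" and \<eta>: "test_function D' \<eta>"
  shows "(LINT x|lborel. \<theta> x * pd i \<eta> x) = - (LINT x|lborel. pd i \<theta> x * \<eta> x)"
proof -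
  obtain S where S: "compact S" "\<And>x. x \<notin> S \<Longrightarrow> \<theta> x = 0" using \<theta> unfolding test_function_def by blast
  note d = test_function_differentiable[OF \<theta>] test_function_differentiable[OF \<eta>]
  note c = test_function_continuous[OF \<theta>] test_function_continuous[OF \<eta>]
    test_function_continuous[OF test_function_pd[OF \<theta>]] test_function_continuous[OF test_function_pd[OF \<eta>]]
  have pd0: "pd i \<theta> x = 0" if "x \<notin> S" for x
    using pd_eq_0_outside[OF compact_imp_closed[OF S(1)] S(2) that] .
  have eq: "pd i (\<lambda>x. \<theta> x * \<eta> x) = (\<lambda>x. \<theta> x * pd i \<eta> x + pd i \<theta> x * \<eta> x)"
    by (intro ext pd_mult d)
  have "0 = (LINT x|lborel. pd i (\<lambda>x. \<theta> x * \<eta> x) x)"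
    by (rule integral_pd_eq_0[symmetric, OF _ _ S(1)])
       (auto simp: eq S intro!: differentiable_mult d continuous_intros c)
  also have "\<dots> = (LINT x|lborel. \<theta> x * pd i \<eta> x) + (LINT x|lborel. pd i \<theta> x * \<eta> x)"
    unfolding eq
    by (intro Bochner_Integration.integral_add integrable_of_compact_support[OF _ S(1)] continuous_intros c) (auto simp: S pd0)
  finally show ?thesis by simp
qed

section \<open>Functions whose integrals over boxes vanish\<close>

text \<open>Within a fixed box, the sets over which \<open>H\<close> integrates to \<open>0\<close> form a Dynkin system
  containing all boxes, which are stable under intersection; hence they comprise all Borel sets.
  Countably many closed boxes cover \<open>D\<close>.\<close>

lemma box_integrals_0_imp_AE_0:
  fixes H :: "real^'n \<Rightarrow> real"
  assumes int: "\<And>c d. cbox c d \<subseteq> D \<Longrightarrow> integrable lebesgue (\<lambda>x. indicator (box c d) x * H x)"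
    and 0: "\<And>c d. cbox c d \<subseteq> D \<Longrightarrow> (LINT x|lebesgue. indicator (box c d) x * H x) = 0"
    and D: "open D"
  shows "AE x in lebesgue. x \<in> D \<longrightarrow> H x = 0"
proof -
  have box: "AE x in lebesgue. x \<in> cbox c d \<longrightarrow> H x = 0" if cd: "cbox c d \<subseteq> D" for c d
  proof -
    define g where "g x = indicator (box c d) x * H x" for x
    have g: "integrable lebesgue g" unfolding g_def by (rule int[OF cd])
    \<comment> \<open>A Borel representative, since boxes generate only the Borel sets.\<close>
    obtain g' where g': "g' \<in> borel_measurable lborel" "AE x in lborel. g x = g' x"
      using completion_ex_borel_measurable_real[OF borel_measurable_integrable[OF g]] by blast
    have m': "g' \<in> borel_measurable lebesgue" using g'(1) by (rule measurable_completion)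
    have ae: "AE x in lebesgue. g x = g' x" by (rule AE_completion[OF g'(2)])
    have "integrable lebesgue g'" by (rule integrable_cong_AE_imp[OF g m' ae])
    then have int': "integrable lborel g'" using integrable_completion[OF g'(1)] by simp
    have conv: "(LINT x:A|lborel. g' x) = (LINT x|lebesgue. indicator A x * g x)" if A: "A \<in> sets borel" for A
    proof -
      have "(LINT x:A|lborel. g' x) = (LINT x|lebesgue. indicator A x *\<^sub>R g' x)"
        unfolding set_lebesgue_integral_def using A g'(1) by (intro integral_completion[symmetric]) auto
      also have "\<dots> = (LINT x|lebesgue. indicator A x * g x)"
      proof (rule integral_cong_AE)
        have "indicator A \<in> borel_measurable lebesgue" using A by (intro measurable_completion) auto
        then show "(\<lambda>x. indicator A x *\<^sub>R g' x) \<in> borel_measurable lebesgue"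
          "(\<lambda>x. indicator A x * g x) \<in> borel_measurable lebesgue"
          using m' g by (auto intro!: borel_measurable_times simp: borel_measurable_integrable)
      qed (use ae in auto)
      finally show ?thesis .
    qed
    have sets_box: "A \<in> sigma_sets UNIV (range (\<lambda>(a, b). box a b :: (real^'n) set)) \<Longrightarrow> A \<in> sets borel" for A
      by (subst borel_eq_box) simp
    have si: "set_integrable lborel B g'" if "B \<in> sets lborel" for B
      unfolding set_integrable_def by (rule integrable_mult_indicator[OF that int'])
    have tot: "(LINT x:UNIV|lborel. g' x) = 0"
      using conv[of UNIV] 0[OF cd] by (simp add: g_def)
    have "(LINT x:A|lborel. g' x) = 0" if "A \<in> sets lborel" for A
    proof -
      have A: "A \<in> sigma_sets UNIV (range (\<lambda>(a, b). box a b :: (real^'n) set))"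
        using that by (simp add: borel_eq_box)
      have stable: "Int_stable (range (\<lambda>(a, b). box a b :: (real^'n) set))"
        by (auto simp: Int_stable_def box_Int_box)
      have Pow: "range (\<lambda>(a, b). box a b :: (real^'n) set) \<subseteq> Pow UNIV" by simp
      show ?thesis
        using stable Pow A
      proof (induction rule: sigma_sets_induct_disjoint)
        case (basic A)
        then obtain a b where A: "A = box a b" by auto
        define l u where "l = (\<Sum>i\<in>Basis. max (a \<bullet> i) (c \<bullet> i) *\<^sub>R i)" and "u = (\<Sum>i\<in>Basis. min (b \<bullet> i) (d \<bullet> i) *\<^sub>R i)"
        have "cbox l u \<subseteq> cbox c d" by (auto simp: l_def u_def mem_box)
        then have *: "cbox l u \<subseteq> D" using cd by blast
        have "(LINT x:A|lborel. g' x) = (LINT x|lebesgue. indicator (box l u) x * H x)"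
          using conv[of A] unfolding A g_def l_def u_def box_Int_box[symmetric]
          by (simp add: indicator_inter_arith mult.assoc)
        then show ?case using 0[OF *] by simp
      next
        case empty
        then show ?case by (simp add: set_lebesgue_integral_def)
      next
        case (compl A)
        have A: "A \<in> sets lborel" using sets_box[OF compl(1)] by simp
        have "(LINT x:(UNIV - A) \<union> A|lborel. g' x) = (LINT x:UNIV - A|lborel. g' x) + (LINT x:A|lborel. g' x)"
          using A by (intro set_integral_Un si) auto
        then show ?case using compl tot by simp
      next
        case (union A)
        have "(LINT x:(\<Union>i. A i)|lborel. g' x) = (\<Sum>i. (LINT x:(A i)|lborel. g' x))"
        proof (rule lebesgue_integral_countable_add)
          show A: "A i \<in> sets lborel" for i using sets_box union(2) by auto
          show "set_integrable lborel (\<Union>i. A i) g'" using A by (intro si) auto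
          show "A i \<inter> A j = {}" if "i \<noteq> j" for i j using union(1) that by (auto simp: disjoint_family_on_def)
        qed
        then show ?case using union by simp
      qed
    qed
    then have "AE x in lborel. g' x = (\<lambda>x. 0) x"
      by (intro density_unique_real int') auto
    then have "AE x in lebesgue. g' x = 0" by (auto intro: AE_completion)
    moreover have "AE x in lebesgue. x \<notin> cbox c d - box c d"
      by (intro AE_not_in) (use negligible_frontier_interval negligible_iff_null_sets in blast)
    ultimately show ?thesis using ae by eventually_elim (auto simp: g_def indicator_def split: if_splits)
  qed
  define a' b' :: "(real^'n \<Rightarrow> real \<times> real) \<Rightarrow> real^'n"
    where "a' f = (\<Sum>i\<in>Basis. fst (f i) *\<^sub>R i)" and "b' f = (\<Sum>i\<in>Basis. snd (f i) *\<^sub>R i)" for f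
  define I where "I = {f\<in>Basis \<rightarrow>\<^sub>E \<rat> \<times> \<rat>. cbox (a' f) (b' f) \<subseteq> D}"
  have "countable I" unfolding I_def
    by (intro countable_Collect countable_PiE) (auto intro: countable_rat)
  then have "AE x in lebesgue. \<forall>f\<in>I. x \<in> cbox (a' f) (b' f) \<longrightarrow> H x = 0"
    by (subst AE_ball_countable) (auto simp: I_def intro: box)
  moreover have "D = (\<Union>f\<in>I. cbox (a' f) (b' f))"
    using open_UNION_cbox[OF D] unfolding I_def a'_def b'_def .
  ultimately show ?thesis by (auto elim!: eventually_mono)
qed

section \<open>Integration over measurable subsets\<close>

lemma open_lebesgue: "open D \<Longrightarrow> D \<in> sets lebesgue"
  by (simp add: borel_open)

lemma integral_lebesgue_on_if:
  fixes f :: "real^'n \<Rightarrow> real"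
  assumes "D \<in> sets lebesgue"
  shows "(LINT x|lebesgue_on D. f x) = (LINT x|lebesgue. (if x \<in> D then f x else 0))"
  using Lebesgue_Measure.integral_restrict_UNIV[OF assms, of f] by simp

lemma integrable_lebesgue_on_if:
  fixes f :: "real^'n \<Rightarrow> real"
  assumes "D \<in> sets lebesgue"
  shows "integrable (lebesgue_on D) f \<longleftrightarrow> integrable lebesgue (\<lambda>x. if x \<in> D then f x else 0)"
proof -
  have "(\<lambda>x. indicat_real D x *\<^sub>R f x) = (\<lambda>x. if x \<in> D then f x else 0)" by (auto simp: indicator_def)
  then show ?thesis using assms by (subst integrable_restrict_space) auto
qed

lemma AE_lebesgue_on_iff:
  assumes "D \<in> sets lebesgue"
  shows "(AE x in lebesgue_on D. P x) \<longleftrightarrow> (AE x in lebesgue. x \<in> D \<longrightarrow> P x)"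
  using assms by (subst AE_restrict_space_iff) auto

lemma AE_lebesgue_on_mono:
  assumes "D \<in> sets lebesgue" "D' \<in> sets lebesgue" "D' \<subseteq> D" "AE x in lebesgue_on D. P x"
  shows "AE x in lebesgue_on D'. P x"
  using assms by (auto simp: AE_lebesgue_on_iff elim!: eventually_mono)

text \<open>Completeness of Lebesgue measure: the integrals of almost everywhere equal functions only agree
  when both are measurable, and this supplies the second measurability.\<close>

lemma borel_measurable_cong_AE_lebesgue_on:
  fixes f g :: "real^'n \<Rightarrow> real"
  assumes D: "D \<in> sets lebesgue" and f: "f \<in> borel_measurable (lebesgue_on D)"
    and ae: "AE x in lebesgue_on D. f x = g x"
  shows "g \<in> borel_measurable (lebesgue_on D)"
proof -
  obtain N where "{x \<in> space lebesgue. \<not> (x \<in> D \<longrightarrow> f x = g x)} \<subseteq> N" "emeasure lebesgue N = 0" "N \<in> sets lebesgue"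
    using ae unfolding AE_lebesgue_on_iff[OF D] by (rule AE_E)
  then have N: "N \<in> null_sets lebesgue" "{x. \<not> (x \<in> D \<longrightarrow> f x = g x)} \<subseteq> N"
    using null_setsI by auto
  have "g measurable_on D"
  proof (rule measurable_on_spike)
    show "f measurable_on D" using f unfolding measurable_on_iff_borel_measurable[OF D] .
    show "negligible N" using N(1) by (simp add: negligible_iff_null_sets)
    show "g x = f x" if "x \<in> D - N" for x using N(2) that by auto
  qed
  then show ?thesis unfolding measurable_on_iff_borel_measurable[OF D] .
qed


section \<open>Square-integrable functions\<close>

lemma L2_borel: "u \<in> L2 D \<Longrightarrow> u \<in> borel_measurable (lebesgue_on D)"
  and L2_square: "u \<in> L2 D \<Longrightarrow> integrable (lebesgue_on D) (\<lambda>x. (u x)\<^sup>2)"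
  by (auto simp: L2_def)

lemma L2_mult_integrable:
  assumes "u \<in> L2 D" "v \<in> L2 D" shows "integrable (lebesgue_on D) (\<lambda>x. u x * v x)"
proof (rule Bochner_Integration.integrable_bound)
  show "integrable (lebesgue_on D) (\<lambda>x. (u x)\<^sup>2 + (v x)\<^sup>2)" using assms by (simp add: L2_def)
  show "(\<lambda>x. u x * v x) \<in> borel_measurable (lebesgue_on D)"
    by (intro borel_measurable_times L2_borel assms)
  have "\<bar>u x * v x\<bar> \<le> (u x)\<^sup>2 + (v x)\<^sup>2" for x
    using sum_squares_bound[of "\<bar>u x\<bar>" "\<bar>v x\<bar>"] abs_ge_zero[of "u x * v x"]
    unfolding abs_mult power2_abs mult.assoc by linarith
  then show "AE x in lebesgue_on D. norm (u x * v x) \<le> norm ((u x)\<^sup>2 + (v x)\<^sup>2)" by auto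
qed

lemma L2_scale: "u \<in> L2 D \<Longrightarrow> (\<lambda>x. a * u x) \<in> L2 D"
  by (auto simp: L2_def power_mult_distrib)

lemma L2_add:
  assumes "u \<in> L2 D" "v \<in> L2 D" shows "(\<lambda>x. u x + v x) \<in> L2 D"
  using assms L2_mult_integrable[OF assms] by (auto simp: L2_def power2_sum mult.assoc)

lemma L2_lincomb: "u \<in> L2 D \<Longrightarrow> v \<in> L2 D \<Longrightarrow> (\<lambda>x. a * u x + b * v x) \<in> L2 D"
  by (intro L2_add L2_scale)

lemma L2_mono:
  assumes D: "D \<in> sets lebesgue" "D' \<in> sets lebesgue" "D' \<subseteq> D" and u: "u \<in> L2 D"
  shows "u \<in> L2 D'"
proof -
  have "integrable lebesgue (\<lambda>x. indicator D' x *\<^sub>R (if x \<in> D then (u x)\<^sup>2 else 0))"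
    using u D by (intro integrable_mult_indicator) (auto simp: L2_def integrable_lebesgue_on_if)
  moreover have "(\<lambda>x. indicator D' x *\<^sub>R (if x \<in> D then (u x)\<^sup>2 else 0)) = (\<lambda>x. if x \<in> D' then (u x)\<^sup>2 else 0)"
    by (intro ext) (use D(3) in \<open>auto simp: indicator_def\<close>)
  ultimately show ?thesis
    using measurable_restrict_mono[OF L2_borel[OF u] D(3)] D(2) by (auto simp: L2_def integrable_lebesgue_on_if)
qed

lemma L2_cong_AE:
  assumes D: "D \<in> sets lebesgue" and u: "u \<in> L2 D" and ae: "AE x in lebesgue_on D. u x = v x"
  shows "v \<in> L2 D"
proof -
  have v: "v \<in> borel_measurable (lebesgue_on D)"
    by (rule borel_measurable_cong_AE_lebesgue_on[OF D L2_borel[OF u] ae])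
  have "integrable (lebesgue_on D) (\<lambda>x. (v x)\<^sup>2)"
    by (rule integrable_cong_AE_imp[OF L2_square[OF u]]) (use v ae in auto)
  with v show ?thesis by (simp add: L2_def)
qed

definition zext :: "'a set \<Rightarrow> ('a \<Rightarrow> 'b::zero) \<Rightarrow> 'a \<Rightarrow> 'b" where
  "zext D u x = (if x \<in> D then u x else 0)"

lemma L2_zext:
  fixes u :: "real^'n \<Rightarrow> real"
  assumes D: "D \<in> sets lebesgue" and u: "u \<in> L2 D" shows "zext D u \<in> L2 UNIV"
proof -
  have "(\<lambda>x. (zext D u x)\<^sup>2) = (\<lambda>x. if x \<in> D then (u x)\<^sup>2 else 0)" by (auto simp: zext_def)
  then show ?thesis using u D borel_measurable_if[OF D, of u]
    by (auto simp: L2_def integrable_lebesgue_on_if lebesgue_on_UNIV_eq zext_def[abs_def])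
qed

text \<open>The quadratic polynomial \<open>t \<mapsto> \<integral>(u - t v)\<^sup>2\<close> is nonnegative, so its discriminant is not positive.\<close>

lemma L2_Cauchy_Schwarz:
  assumes u: "u \<in> L2 D" and v: "v \<in> L2 D"
  shows "\<bar>LINT x|lebesgue_on D. u x * v x\<bar> \<le>
     sqrt (LINT x|lebesgue_on D. (u x)\<^sup>2) * sqrt (LINT x|lebesgue_on D. (v x)\<^sup>2)"
proof -
  define a b c where "a = (LINT x|lebesgue_on D. (u x)\<^sup>2)" and "b = (LINT x|lebesgue_on D. u x * v x)"
    and "c = (LINT x|lebesgue_on D. (v x)\<^sup>2)"
  have q: "0 \<le> a - 2 * t * b + t\<^sup>2 * c" for t
  proof -
    have "0 \<le> (LINT x|lebesgue_on D. (u x - t * v x)\<^sup>2)" by (rule integral_nonneg_AE) simp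
    also have "\<dots> = (LINT x|lebesgue_on D. (u x)\<^sup>2 - 2 * t * (u x * v x) + t\<^sup>2 * (v x)\<^sup>2)"
      by (intro Bochner_Integration.integral_cong) (auto simp: power2_eq_square algebra_simps)
    also have "\<dots> = a - 2 * t * b + t\<^sup>2 * c"
      using L2_square[OF u] L2_square[OF v] L2_mult_integrable[OF u v] by (simp add: a_def b_def c_def)
    finally show ?thesis .
  qed
  have c: "c \<ge> 0" "a \<ge> 0" unfolding a_def c_def by (auto intro: integral_nonneg_AE)
  have "b\<^sup>2 \<le> a * c"
  proof (cases "c = 0")
    case True
    have "b = 0"
    proof (rule ccontr)
      \<comment> \<open>The polynomial is affine and takes the value \<open>- a - 2\<close> at the point below.\<close>
      assume "b \<noteq> 0"
      then show False using q[of "(a + 1) / b"] True c by simp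
    qed
    then show ?thesis using c by simp
  next
    case False
    then have "0 \<le> c * (a - 2 * (b / c) * b + (b / c)\<^sup>2 * c)" using q[of "b / c"] c by (intro mult_nonneg_nonneg)
    also have "\<dots> = a * c - b\<^sup>2" using False by (simp add: field_simps power2_eq_square)
    finally show ?thesis by simp
  qed
  then have "sqrt (b\<^sup>2) \<le> sqrt (a * c)" by (rule real_sqrt_le_mono)
  then show ?thesis by (simp add: a_def b_def c_def real_sqrt_mult)
qed

lemma test_function_L2:
  assumes \<theta>: "test_function D' \<theta>" and D: "D \<in> sets lebesgue" shows "\<theta> \<in> L2 D"
proof -
  obtain S where S: "compact S" "\<And>x. x \<notin> S \<Longrightarrow> \<theta> x = 0" using \<theta> unfolding test_function_def by blast
  have "integrable lborel (\<lambda>x. (\<theta> x)\<^sup>2)"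
    by (rule integrable_of_compact_support[OF _ S(1)])
       (auto simp: S intro!: continuous_intros test_function_continuous[OF \<theta>])
  then have "integrable lebesgue (\<lambda>x. (\<theta> x)\<^sup>2)"
    using test_function_borel[OF \<theta>] by (subst integrable_completion) auto
  then have "\<theta> \<in> L2 UNIV" using measurable_completion[of \<theta> lborel borel] test_function_borel[OF \<theta>]
    by (auto simp: L2_def lebesgue_on_UNIV_eq)
  then show ?thesis by (rule L2_mono[rotated 3]) (use D in auto)
qed

text \<open>Bump functions converge to indicators of boxes, so the integrals over all boxes inside \<open>D\<close> vanish.\<close>

lemma L2_orthogonal_to_test_functions:
  assumes D: "open D" and h: "h \<in> L2 D"
    and 0: "\<And>\<theta>. test_function D \<theta> \<Longrightarrow> (LINT x|lebesgue_on D. h x * \<theta> x) = 0"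
  shows "AE x in lebesgue_on D. h x = 0"
proof -
  note D' = open_lebesgue[OF D]
  have H: "zext D h \<in> L2 UNIV" by (rule L2_zext[OF D' h])
  have mH: "zext D h \<in> borel_measurable lebesgue" using L2_borel[OF H] by (simp add: lebesgue_on_UNIV_eq)
  have int: "integrable lebesgue (\<lambda>x. indicator S x * zext D h x)"
    if S: "S \<in> sets borel" "emeasure lborel S < \<infinity>" for S
  proof (rule Bochner_Integration.integrable_bound)
    have "integrable lborel (indicator S :: real^'a \<Rightarrow> real)"
      using S by (intro integrable_real_indicator) auto
    then have i: "integrable lebesgue (indicator S :: real^'a \<Rightarrow> real)"
      using S by (subst integrable_completion) auto
    show "integrable lebesgue (\<lambda>x. indicator S x + (zext D h x)\<^sup>2)"
      using i L2_square[OF H] by (intro Bochner_Integration.integrable_add) (auto simp: lebesgue_on_UNIV_eq)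
    show "(\<lambda>x. indicator S x * zext D h x) \<in> borel_measurable lebesgue"
      using mH i by (intro borel_measurable_times borel_measurable_integrable[OF i])
    have "\<bar>t\<bar> \<le> 1 + t\<^sup>2" for t :: real
      using sum_squares_bound[of 1 "\<bar>t\<bar>"] by simp
    then show "AE x in lebesgue. norm (indicator S x * zext D h x) \<le> norm (indicator S x + (zext D h x)\<^sup>2)"
      by (auto simp: indicator_def)
  qed
  have "AE x in lebesgue. x \<in> D \<longrightarrow> zext D h x = 0"
  proof (rule box_integrals_0_imp_AE_0[OF _ _ D])
    fix c d assume cd: "cbox c d \<subseteq> D"
    show "integrable lebesgue (\<lambda>x. indicator (box c d) x * zext D h x)"
      by (rule int) (auto simp: emeasure_lborel_box_eq)
    have "(\<lambda>n. LINT x|lebesgue. bump c d n x * zext D h x) \<longlonglongrightarrow> (LINT x|lebesgue. indicator (box c d) x * zext D h x)"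
    proof (rule integral_dominated_convergence)
      show "(\<lambda>x. indicator (box c d) x * zext D h x) \<in> borel_measurable lebesgue"
        by (intro borel_measurable_integrable int) (auto simp: emeasure_lborel_box_eq)
      show "(\<lambda>x. bump c d n x * zext D h x) \<in> borel_measurable lebesgue" for n
        using test_function_borel[OF test_function_bump[OF cd]]
        by (intro borel_measurable_times mH) (auto intro: measurable_completion)
      show "integrable lebesgue (\<lambda>x. \<bar>indicator (cbox c d) x * zext D h x\<bar>)"
        by (intro integrable_abs int) (auto simp: emeasure_lborel_cbox_eq)
      show "AE x in lebesgue. (\<lambda>n. bump c d n x * zext D h x) \<longlonglongrightarrow> indicator (box c d) x * zext D h x"
        by (intro always_eventually allI tendsto_mult bump_tendsto_indicator tendsto_const)
      show "AE x in lebesgue. norm (bump c d n x * zext D h x) \<le> \<bar>indicator (cbox c d) x * zext D h x\<bar>" for n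
      proof (intro always_eventually allI)
        fix x
        show "norm (bump c d n x * zext D h x) \<le> \<bar>indicator (cbox c d) x * zext D h x\<bar>"
          using bump_bounds[of c d n x] test_function_outside[OF test_function_bump[OF order_refl], of x c d n]
          by (auto simp: indicator_def abs_mult intro: mult_left_le_one_le)
      qed
    qed
    moreover have "(LINT x|lebesgue. bump c d n x * zext D h x) = 0" for n
      using 0[OF test_function_bump[OF cd], of n] unfolding integral_lebesgue_on_if[OF D']
      by (simp add: zext_def mult.commute if_distrib cong: if_cong)
    ultimately show "(LINT x|lebesgue. indicator (box c d) x * zext D h x) = 0"
      by (simp add: LIMSEQ_const_iff)
  qed
  then show ?thesis unfolding AE_lebesgue_on_iff[OF D'] by (auto simp: zext_def elim!: eventually_mono)
qed


section \<open>Weak gradients\<close>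

lemma has_weak_gradient_L2: "has_weak_gradient D u g \<Longrightarrow> (\<lambda>x. g x $ i) \<in> L2 D"
  and has_weak_gradient_test: "has_weak_gradient D u g \<Longrightarrow> test_function D \<theta> \<Longrightarrow>
    (LINT x|lebesgue_on D. u x * pd i \<theta> x) = - (LINT x|lebesgue_on D. g x $ i * \<theta> x)"
  by (auto simp: has_weak_gradient_def)

text \<open>The components of the difference of two weak gradients are orthogonal to all test functions.\<close>

lemma has_weak_gradient_unique:
  assumes D: "open D" and g: "has_weak_gradient D u g" and g': "has_weak_gradient D u g'"
  shows "AE x in lebesgue_on D. g x = g' x"
proof -
  note D' = open_lebesgue[OF D]
  have "AE x in lebesgue_on D. 1 * g x $ i + (-1) * g' x $ i = 0" for i
  proof (rule L2_orthogonal_to_test_functions[OF D L2_lincomb[OF has_weak_gradient_L2[OF g] has_weak_gradient_L2[OF g']]])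
    fix \<theta> assume \<theta>: "test_function D \<theta>"
    show "(LINT x|lebesgue_on D. (1 * g x $ i + (-1) * g' x $ i) * \<theta> x) = 0"
      using L2_mult_integrable[OF has_weak_gradient_L2[OF g] test_function_L2[OF \<theta> D'], of i]
        L2_mult_integrable[OF has_weak_gradient_L2[OF g'] test_function_L2[OF \<theta> D'], of i]
        has_weak_gradient_test[OF g \<theta>, of i] has_weak_gradient_test[OF g' \<theta>, of i]
      by (simp add: left_diff_distrib)
  qed
  then have "AE x in lebesgue_on D. \<forall>i\<in>UNIV. 1 * g x $ i + (-1) * g' x $ i = 0"
    by (subst AE_ball_countable) auto
  then show ?thesis by eventually_elim (simp add: vec_eq_iff)
qed

lemma has_weak_gradient_cong_AE:
  assumes D: "D \<in> sets lebesgue" and u: "u \<in> L2 D" and ae: "AE x in lebesgue_on D. u x = u' x"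
  shows "has_weak_gradient D u g \<longleftrightarrow> has_weak_gradient D u' g"
proof -
  have "(LINT x|lebesgue_on D. u x * pd i \<theta> x) = (LINT x|lebesgue_on D. u' x * pd i \<theta> x)"
    if \<theta>: "test_function D \<theta>" for i \<theta>
    using L2_borel[OF u] L2_borel[OF L2_cong_AE[OF D u ae]] L2_borel[OF test_function_L2[OF test_function_pd[OF \<theta>] D]]
    by (intro integral_cong_AE borel_measurable_times) (use ae in auto)
  then show ?thesis by (auto simp: has_weak_gradient_def)
qed

lemma has_weak_gradient_lincomb:
  assumes D: "D \<in> sets lebesgue" and L: "u \<in> L2 D" "v \<in> L2 D"
    and u: "has_weak_gradient D u g" and v: "has_weak_gradient D v h"
  shows "has_weak_gradient D (\<lambda>x. a * u x + b * v x) (\<lambda>x. a *\<^sub>R g x + b *\<^sub>R h x)"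
  unfolding has_weak_gradient_def
proof (intro conjI allI impI)
  fix i show "(\<lambda>x. (a *\<^sub>R g x + b *\<^sub>R h x) $ i) \<in> L2 D"
    using L2_lincomb[OF has_weak_gradient_L2[OF u] has_weak_gradient_L2[OF v]] by simp
next
  fix \<theta> i assume \<theta>: "test_function D \<theta>"
  have 1: "(LINT x|lebesgue_on D. (a * p x + b * q x) * r x) =
      a * (LINT x|lebesgue_on D. p x * r x) + b * (LINT x|lebesgue_on D. q x * r x)"
    if "p \<in> L2 D" "q \<in> L2 D" "r \<in> L2 D" for p q r
    using L2_mult_integrable[OF that(1,3)] L2_mult_integrable[OF that(2,3)]
    by (simp add: distrib_right mult.assoc)
  show "(LINT x|lebesgue_on D. (a * u x + b * v x) * pd i \<theta> x) =
      - (LINT x|lebesgue_on D. (a *\<^sub>R g x + b *\<^sub>R h x) $ i * \<theta> x)"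
    using 1[OF L test_function_L2[OF test_function_pd[OF \<theta>] D]]
      1[OF has_weak_gradient_L2[OF u] has_weak_gradient_L2[OF v] test_function_L2[OF \<theta> D]]
      has_weak_gradient_test[OF u \<theta>] has_weak_gradient_test[OF v \<theta>]
    by simp
qed

text \<open>A test function on the smaller set is one on the larger set, and its support confines the integrals.\<close>

lemma has_weak_gradient_mono:
  assumes D: "D \<in> sets lebesgue" "D' \<in> sets lebesgue" "D' \<subseteq> D" and u: "has_weak_gradient D u g"
  shows "has_weak_gradient D' u g"
  unfolding has_weak_gradient_def
proof (intro conjI allI impI)
  fix i show "(\<lambda>x. g x $ i) \<in> L2 D'" by (rule L2_mono[OF D has_weak_gradient_L2[OF u]])
next
  fix \<theta> i assume \<theta>: "test_function D' \<theta>"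
  have eq: "(LINT x|lebesgue_on D'. p x * r x) = (LINT x|lebesgue_on D. p x * r x)"
    if "\<And>x. x \<notin> D' \<Longrightarrow> r x = 0" for p r :: "real^'a \<Rightarrow> real"
    unfolding integral_lebesgue_on_if[OF D(1)] integral_lebesgue_on_if[OF D(2)] using D(3) that
    by (intro Bochner_Integration.integral_cong) auto
  show "(LINT x|lebesgue_on D'. u x * pd i \<theta> x) = - (LINT x|lebesgue_on D'. g x $ i * \<theta> x)"
    using has_weak_gradient_test[OF u test_function_mono[OF \<theta> D(3)]]
      eq[OF test_function_outside[OF \<theta>]] eq[OF test_function_outside[OF test_function_pd[OF \<theta>]]] by simp
qed

lemma has_weak_gradient_test_function:
  assumes \<theta>: "test_function D' \<theta>"
  shows "has_weak_gradient UNIV \<theta> (\<lambda>x. \<chi> i. pd i \<theta> x)"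
  unfolding has_weak_gradient_def
proof (intro conjI allI impI)
  fix i show "(\<lambda>x. (\<chi> i. pd i \<theta> x) $ i) \<in> L2 UNIV"
    using test_function_L2[OF test_function_pd[OF \<theta>], of UNIV i] by simp
next
  fix \<eta> :: "real^'a \<Rightarrow> real" and i assume \<eta>: "test_function UNIV \<eta>"
  have "(LINT x|lebesgue. \<theta> x * pd i \<eta> x) = (LINT x|lborel. \<theta> x * pd i \<eta> x)"
    "(LINT x|lebesgue. pd i \<theta> x * \<eta> x) = (LINT x|lborel. pd i \<theta> x * \<eta> x)"
    using test_function_borel[OF \<theta>] test_function_borel[OF \<eta>] test_function_borel[OF test_function_pd[OF \<theta>]]
      test_function_borel[OF test_function_pd[OF \<eta>]]
    by (auto intro!: integral_completion borel_measurable_times)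
  then show "(LINT x|lebesgue_on UNIV. \<theta> x * pd i \<eta> x) = - (LINT x|lebesgue_on UNIV. (\<chi> i. pd i \<theta> x) $ i * \<eta> x)"
    using integration_by_parts[OF \<theta> \<eta>, of i] by (simp add: lebesgue_on_UNIV_eq)
qed

section \<open>Sobolev spaces and extension by zero\<close>

lemma H1_L2: "u \<in> H1 D \<Longrightarrow> u \<in> L2 D"
  by (simp add: H1_def)

lemma has_weak_gradient_wgrad: "u \<in> H1 D \<Longrightarrow> has_weak_gradient D u (wgrad D u)"
  unfolding H1_def wgrad_def by (simp add: someI_ex)

lemma H1I: "u \<in> L2 D \<Longrightarrow> has_weak_gradient D u g \<Longrightarrow> u \<in> H1 D"
  unfolding H1_def by blast

lemma wgrad_AE_eq:
  assumes "open D" "has_weak_gradient D u g" shows "AE x in lebesgue_on D. wgrad D u x = g x"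
  by (rule has_weak_gradient_unique[OF assms(1) _ assms(2)]) (metis assms(2) someI wgrad_def)

lemma H1_lincomb:
  assumes "D \<in> sets lebesgue" "u \<in> H1 D" "v \<in> H1 D" shows "(\<lambda>x. a * u x + b * v x) \<in> H1 D"
  using assms by (blast intro: H1I L2_lincomb H1_L2 has_weak_gradient_lincomb has_weak_gradient_wgrad)

lemma H1_diff:
  assumes "D \<in> sets lebesgue" "u \<in> H1 D" "v \<in> H1 D" shows "(\<lambda>x. u x - v x) \<in> H1 D"
  using H1_lincomb[OF assms, of 1 "-1"] by simp

lemma H1_add:
  assumes "D \<in> sets lebesgue" "u \<in> H1 D" "v \<in> H1 D" shows "(\<lambda>x. u x + v x) \<in> H1 D"
  using H1_lincomb[OF assms, of 1 1] by simp

lemma H1_mono: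
  assumes "D \<in> sets lebesgue" "D' \<in> sets lebesgue" "D' \<subseteq> D" "u \<in> H1 D" shows "u \<in> H1 D'"
  using assms by (blast intro: H1I L2_mono H1_L2 has_weak_gradient_mono has_weak_gradient_wgrad)

lemma H1_cong_AE:
  assumes D: "D \<in> sets lebesgue" and u: "u \<in> H1 D" and ae: "AE x in lebesgue_on D. u x = v x"
  shows "v \<in> H1 D"
  using has_weak_gradient_cong_AE[OF D H1_L2[OF u] ae] has_weak_gradient_wgrad[OF u]
    L2_cong_AE[OF D H1_L2[OF u] ae] by (blast intro: H1I)

lemma L2_zero: "(\<lambda>x. 0) \<in> L2 D"
  by (simp add: L2_def)

lemma has_weak_gradient_zero: "has_weak_gradient D (\<lambda>x. 0) (\<lambda>x. 0)"
  by (simp add: has_weak_gradient_def L2_zero)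

lemma H1_zero: "(\<lambda>x. 0) \<in> H1 D"
  by (rule H1I[OF L2_zero has_weak_gradient_zero])

lemma H1_sum:
  assumes D: "D \<in> sets lebesgue" shows "(\<And>k. k \<in> I \<Longrightarrow> w k \<in> H1 D) \<Longrightarrow> (\<lambda>x. \<Sum>k\<in>I. w k x) \<in> H1 D"
  by (induction I rule: infinite_finite_induct) (auto intro: H1_zero H1_add[OF D])

lemma norm_power2_cart: "(norm x)\<^sup>2 = (\<Sum>i\<in>UNIV. (x $ i)\<^sup>2)" for x :: "real^'n"
  unfolding power2_norm_eq_inner inner_vec_def by (simp add: power2_eq_square)

lemma integrable_norm_gradient:
  assumes "has_weak_gradient D u g" shows "integrable (lebesgue_on D) (\<lambda>x. (norm (g x))\<^sup>2)"
  unfolding norm_power2_cart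
  by (intro Bochner_Integration.integrable_sum L2_square[OF has_weak_gradient_L2[OF assms]])

lemma h1norm_power2:
  "(h1norm D u)\<^sup>2 = (LINT x|lebesgue_on D. (u x)\<^sup>2) + (LINT x|lebesgue_on D. (norm (wgrad D u x))\<^sup>2)"
  unfolding h1norm_def by (intro real_sqrt_pow2 add_nonneg_nonneg integral_nonneg_AE) auto

lemma h1norm_nonneg: "h1norm D u \<ge> 0"
  unfolding h1norm_def by (intro real_sqrt_ge_zero add_nonneg_nonneg integral_nonneg_AE) auto

lemma h1norm_ge:
  "sqrt (LINT x|lebesgue_on D. (u x)\<^sup>2) \<le> h1norm D u"
  "sqrt (LINT x|lebesgue_on D. (norm (wgrad D u x))\<^sup>2) \<le> h1norm D u"
  unfolding h1norm_def by (auto intro: integral_nonneg_AE)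

lemma h1norm_diff:
  assumes D: "open D" and u: "u \<in> H1 D" and v: "v \<in> H1 D"
  shows "(h1norm D (\<lambda>x. u x - v x))\<^sup>2 \<le> 2 * (h1norm D u)\<^sup>2 + 2 * (h1norm D v)\<^sup>2"
proof -
  note gu = has_weak_gradient_wgrad[OF u] and gv = has_weak_gradient_wgrad[OF v]
  have uv: "(\<lambda>x. u x - v x) \<in> H1 D" by (rule H1_diff[OF open_lebesgue[OF D] u v])
  have "AE x in lebesgue_on D. wgrad D (\<lambda>x. 1 * u x + (-1) * v x) x = 1 *\<^sub>R wgrad D u x + (-1) *\<^sub>R wgrad D v x"
    by (rule wgrad_AE_eq[OF D has_weak_gradient_lincomb[OF open_lebesgue[OF D] H1_L2[OF u] H1_L2[OF v] gu gv]])
  then have g: "AE x in lebesgue_on D. wgrad D (\<lambda>x. u x - v x) x = wgrad D u x - wgrad D v x" by simp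
  have sq: "(norm (p - q))\<^sup>2 \<le> 2 * (norm p)\<^sup>2 + 2 * (norm q)\<^sup>2" for p q :: "'z::real_inner"
  proof -
    have "0 \<le> (norm (p + q))\<^sup>2" by simp
    then show ?thesis unfolding power2_norm_eq_inner by (simp add: inner_add inner_diff inner_commute)
  qed
  have 1: "(LINT x|lebesgue_on D. (u x - v x)\<^sup>2) \<le> (LINT x|lebesgue_on D. 2 * (u x)\<^sup>2 + 2 * (v x)\<^sup>2)"
    using sq[of "u _" "v _"] L2_square[OF H1_L2[OF u]] L2_square[OF H1_L2[OF v]] L2_square[OF H1_L2[OF uv]]
    by (intro integral_mono) auto
  have 2: "(LINT x|lebesgue_on D. (norm (wgrad D (\<lambda>x. u x - v x) x))\<^sup>2) \<le>
      (LINT x|lebesgue_on D. 2 * (norm (wgrad D u x))\<^sup>2 + 2 * (norm (wgrad D v x))\<^sup>2)"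
  proof (rule integral_mono_AE)
    show "AE x in lebesgue_on D. (norm (wgrad D (\<lambda>x. u x - v x) x))\<^sup>2 \<le> 2 * (norm (wgrad D u x))\<^sup>2 + 2 * (norm (wgrad D v x))\<^sup>2"
      using g by eventually_elim (simp only: sq)
  qed (use integrable_norm_gradient[OF gu] integrable_norm_gradient[OF gv]
        integrable_norm_gradient[OF has_weak_gradient_wgrad[OF uv]] in auto)
  from 1 2 show ?thesis unfolding h1norm_power2
    using L2_square[OF H1_L2[OF u]] L2_square[OF H1_L2[OF v]] integrable_norm_gradient[OF gu] integrable_norm_gradient[OF gv]
    by simp
qed

lemma H10_H1: "u \<in> H10 D \<Longrightarrow> u \<in> H1 D"
  by (simp add: H10_def)

lemma test_function_weak_gradient:
  assumes D: "open D" and \<theta>: "test_function D' \<theta>"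
  shows "has_weak_gradient D \<theta> (\<lambda>x. \<chi> i. pd i \<theta> x)"
  by (rule has_weak_gradient_mono[OF _ open_lebesgue[OF D] _ has_weak_gradient_test_function[OF \<theta>]]) auto

lemma test_function_H1: "open D \<Longrightarrow> test_function D' \<theta> \<Longrightarrow> \<theta> \<in> H1 D"
  by (blast intro: H1I test_function_weak_gradient test_function_L2 open_lebesgue)

lemma H10_diff:
  assumes D: "open D" and u: "u \<in> H10 D" and v: "v \<in> H10 D"
  shows "(\<lambda>x. u x - v x) \<in> H10 D"
proof -
  obtain \<theta> \<eta> where \<theta>: "\<And>n. test_function D (\<theta> n)" "(\<lambda>n. h1norm D (\<lambda>x. u x - \<theta> n x)) \<longlonglongrightarrow> 0"
    and \<eta>: "\<And>n. test_function D (\<eta> n)" "(\<lambda>n. h1norm D (\<lambda>x. v x - \<eta> n x)) \<longlonglongrightarrow> 0"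
    using u v unfolding H10_def by blast
  have "(\<lambda>n. h1norm D (\<lambda>x. (u x - v x) - (\<theta> n x - \<eta> n x))) \<longlonglongrightarrow> 0"
  proof (rule tendsto_sandwich[OF _ _ tendsto_const])
    show "(\<lambda>n. sqrt (2 * (h1norm D (\<lambda>x. u x - \<theta> n x))\<^sup>2 + 2 * (h1norm D (\<lambda>x. v x - \<eta> n x))\<^sup>2)) \<longlonglongrightarrow> 0"
      using \<theta>(2) \<eta>(2) by (auto intro!: tendsto_eq_intros)
    have "h1norm D (\<lambda>x. (u x - v x) - (\<theta> n x - \<eta> n x)) \<le>
       sqrt (2 * (h1norm D (\<lambda>x. u x - \<theta> n x))\<^sup>2 + 2 * (h1norm D (\<lambda>x. v x - \<eta> n x))\<^sup>2)" for n
    proof (rule real_le_rsqrt)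
      have eq: "(\<lambda>x. (u x - v x) - (\<theta> n x - \<eta> n x)) = (\<lambda>x. (u x - \<theta> n x) - (v x - \<eta> n x))" by auto
      show "(h1norm D (\<lambda>x. (u x - v x) - (\<theta> n x - \<eta> n x)))\<^sup>2 \<le>
         2 * (h1norm D (\<lambda>x. u x - \<theta> n x))\<^sup>2 + 2 * (h1norm D (\<lambda>x. v x - \<eta> n x))\<^sup>2"
        unfolding eq using u v \<theta>(1) \<eta>(1)
        by (intro h1norm_diff[OF D] H1_diff open_lebesgue[OF D] test_function_H1[OF D] H10_H1) auto
    qed
    then show "\<forall>\<^sub>F n in sequentially. h1norm D (\<lambda>x. (u x - v x) - (\<theta> n x - \<eta> n x)) \<le>
       sqrt (2 * (h1norm D (\<lambda>x. u x - \<theta> n x))\<^sup>2 + 2 * (h1norm D (\<lambda>x. v x - \<eta> n x))\<^sup>2)" by simp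
  qed (simp add: h1norm_nonneg)
  moreover have "test_function D (\<lambda>x. \<theta> n x - \<eta> n x)" for n by (rule test_function_diff[OF \<theta>(1) \<eta>(1)])
  moreover have "(\<lambda>x. u x - v x) \<in> H1 D" by (rule H1_diff[OF open_lebesgue[OF D] H10_H1[OF u] H10_H1[OF v]])
  ultimately show ?thesis
    unfolding H10_def mem_Collect_eq by (intro conjI exI[of _ "\<lambda>n x. \<theta> n x - \<eta> n x"]) auto
qed

lemma integral_UNIV_eq_lebesgue_on:
  fixes f :: "real^'n \<Rightarrow> real"
  assumes "D \<in> sets lebesgue" "\<And>x. x \<in> D \<Longrightarrow> F x = f x" "\<And>x. x \<notin> D \<Longrightarrow> F x = 0"
  shows "(LINT x|lebesgue_on UNIV. F x) = (LINT x|lebesgue_on D. f x)"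
  unfolding integral_lebesgue_on_if[OF assms(1)] lebesgue_on_UNIV_eq
  by (intro Bochner_Integration.integral_cong) (use assms in auto)

text \<open>Test functions on the whole space are allowed here, although they need not vanish on the boundary
  of \<open>D\<close>: boundary terms are absent because \<open>v\<close> is a limit of functions with compact support in \<open>D\<close>.
  For these the formula is classical, and by Cauchy-Schwarz the defect of \<open>v\<close> is at most a
  constant times the distance of \<open>v\<close> to each of them.\<close>

lemma H10_integration_by_parts:
  assumes D: "open D" and v: "v \<in> H10 D" and \<eta>: "test_function UNIV \<eta>"
  shows "(LINT x|lebesgue_on D. v x * pd i \<eta> x) = - (LINT x|lebesgue_on D. wgrad D v x $ i * \<eta> x)"
proof -
  note D' = open_lebesgue[OF D]
  define \<eta>' where "\<eta>' = pd i \<eta>"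
  obtain \<theta> where \<theta>: "\<And>n. test_function D (\<theta> n)" "(\<lambda>n. h1norm D (\<lambda>x. v x - \<theta> n x)) \<longlonglongrightarrow> 0"
    using v unfolding H10_def by blast
  have v1: "v \<in> H1 D" by (rule H10_H1[OF v])
  note gv = has_weak_gradient_wgrad[OF v1]
  have L: "\<eta> \<in> L2 D" "\<eta>' \<in> L2 D" unfolding \<eta>'_def
    by (intro test_function_L2[OF \<eta> D'] test_function_L2[OF test_function_pd[OF \<eta>] D'])+
  define r where "r = (LINT x|lebesgue_on D. v x * \<eta>' x) + (LINT x|lebesgue_on D. wgrad D v x $ i * \<eta> x)"
  define N where "N = sqrt (LINT x|lebesgue_on D. (\<eta>' x)\<^sup>2) + sqrt (LINT x|lebesgue_on D. (\<eta> x)\<^sup>2)"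
  have bound: "\<bar>r\<bar> \<le> h1norm D (\<lambda>x. v x - \<theta> n x) * N" for n
  proof -
    define w where "w = (\<lambda>x. v x - \<theta> n x)"
    have \<theta>1: "\<theta> n \<in> H1 D" by (rule test_function_H1[OF D \<theta>(1)])
    have w: "w \<in> H1 D" unfolding w_def by (rule H1_diff[OF D' v1 \<theta>1])
    note gw = has_weak_gradient_wgrad[OF w]
    have g\<theta>: "has_weak_gradient D (\<theta> n) (\<lambda>x. \<chi> i. pd i (\<theta> n) x)" by (rule test_function_weak_gradient[OF D \<theta>(1)])
    have "(LINT x|lebesgue_on UNIV. \<theta> n x * \<eta>' x) = - (LINT x|lebesgue_on UNIV. pd i (\<theta> n) x * \<eta> x)"
      using has_weak_gradient_test[OF has_weak_gradient_test_function[OF \<theta>(1)] \<eta>, of n i] by (simp add: \<eta>'_def)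
    moreover have "(LINT x|lebesgue_on UNIV. \<theta> n x * \<eta>' x) = (LINT x|lebesgue_on D. \<theta> n x * \<eta>' x)"
      by (rule integral_UNIV_eq_lebesgue_on[OF D']) (auto simp: test_function_outside[OF \<theta>(1)])
    moreover have "(LINT x|lebesgue_on UNIV. pd i (\<theta> n) x * \<eta> x) = (LINT x|lebesgue_on D. pd i (\<theta> n) x * \<eta> x)"
      by (rule integral_UNIV_eq_lebesgue_on[OF D']) (auto simp: test_function_outside[OF test_function_pd[OF \<theta>(1)]])
    ultimately have 0: "(LINT x|lebesgue_on D. \<theta> n x * \<eta>' x) + (LINT x|lebesgue_on D. pd i (\<theta> n) x * \<eta> x) = 0" by simp
    have "has_weak_gradient D (\<lambda>x. 1 * w x + 1 * \<theta> n x) (\<lambda>x. 1 *\<^sub>R wgrad D w x + 1 *\<^sub>R (\<chi> i. pd i (\<theta> n) x))"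
      by (rule has_weak_gradient_lincomb[OF D' H1_L2[OF w] H1_L2[OF \<theta>1] gw g\<theta>])
    moreover have "(\<lambda>x. 1 * w x + 1 * \<theta> n x) = v" by (auto simp: w_def)
    ultimately have ae: "AE x in lebesgue_on D. wgrad D v x = wgrad D w x + (\<chi> i. pd i (\<theta> n) x)"
      using wgrad_AE_eq[OF D] by fastforce
    have Lg: "(\<lambda>x. wgrad D w x $ i) \<in> L2 D" "(\<lambda>x. pd i (\<theta> n) x) \<in> L2 D"
      by (rule has_weak_gradient_L2[OF gw], rule test_function_L2[OF test_function_pd[OF \<theta>(1)] D'])
    have "(LINT x|lebesgue_on D. v x * \<eta>' x) = (LINT x|lebesgue_on D. w x * \<eta>' x + \<theta> n x * \<eta>' x)"
      by (simp add: w_def algebra_simps)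
    also have "\<dots> = (LINT x|lebesgue_on D. w x * \<eta>' x) + (LINT x|lebesgue_on D. \<theta> n x * \<eta>' x)"
      using L2_mult_integrable[OF H1_L2[OF w] L(2)] L2_mult_integrable[OF H1_L2[OF \<theta>1] L(2)] by simp
    finally have 1: "(LINT x|lebesgue_on D. v x * \<eta>' x) = (LINT x|lebesgue_on D. w x * \<eta>' x) + (LINT x|lebesgue_on D. \<theta> n x * \<eta>' x)" .
    have "(LINT x|lebesgue_on D. wgrad D v x $ i * \<eta> x) = (LINT x|lebesgue_on D. wgrad D w x $ i * \<eta> x + pd i (\<theta> n) x * \<eta> x)"
    proof (rule integral_cong_AE)
      show "AE x in lebesgue_on D. wgrad D v x $ i * \<eta> x = wgrad D w x $ i * \<eta> x + pd i (\<theta> n) x * \<eta> x"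
        using ae by eventually_elim (simp add: algebra_simps)
    qed (intro borel_measurable_times borel_measurable_add L2_borel L Lg has_weak_gradient_L2[OF gv])+
    also have "\<dots> = (LINT x|lebesgue_on D. wgrad D w x $ i * \<eta> x) + (LINT x|lebesgue_on D. pd i (\<theta> n) x * \<eta> x)"
      using L2_mult_integrable[OF Lg(1) L(1)] L2_mult_integrable[OF Lg(2) L(1)] by simp
    finally have "r = (LINT x|lebesgue_on D. w x * \<eta>' x) + (LINT x|lebesgue_on D. wgrad D w x $ i * \<eta> x)"
      unfolding r_def 1 using 0 by simp
    moreover have "\<bar>LINT x|lebesgue_on D. w x * \<eta>' x\<bar> \<le> h1norm D w * sqrt (LINT x|lebesgue_on D. (\<eta>' x)\<^sup>2)"
      by (rule order_trans[OF L2_Cauchy_Schwarz[OF H1_L2[OF w] L(2)]])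
         (intro mult_right_mono h1norm_ge real_sqrt_ge_zero integral_nonneg_AE always_eventually allI zero_le_power2)
    moreover have "\<bar>LINT x|lebesgue_on D. wgrad D w x $ i * \<eta> x\<bar> \<le> h1norm D w * sqrt (LINT x|lebesgue_on D. (\<eta> x)\<^sup>2)"
    proof (rule order_trans[OF L2_Cauchy_Schwarz[OF Lg(1) L(1)]], rule mult_right_mono)
      have "(wgrad D w x $ i)\<^sup>2 \<le> (norm (wgrad D w x))\<^sup>2" for x
        using component_le_norm_cart[of "wgrad D w x" i] by (metis abs_ge_zero power2_abs power_mono)
      then have "(LINT x|lebesgue_on D. (wgrad D w x $ i)\<^sup>2) \<le> (LINT x|lebesgue_on D. (norm (wgrad D w x))\<^sup>2)"
        by (intro integral_mono L2_square[OF Lg(1)] integrable_norm_gradient[OF gw])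
      then show "sqrt (LINT x|lebesgue_on D. (wgrad D w x $ i)\<^sup>2) \<le> h1norm D w"
        using h1norm_ge(2)[of D w] by (meson order_trans real_sqrt_le_mono)
    qed (intro real_sqrt_ge_zero integral_nonneg_AE always_eventually allI zero_le_power2)
    ultimately show ?thesis unfolding N_def w_def by (simp add: distrib_left)
  qed
  have "(\<lambda>n. h1norm D (\<lambda>x. v x - \<theta> n x) * N) \<longlonglongrightarrow> 0 * N" by (intro tendsto_mult \<theta>(2) tendsto_const)
  then have "\<bar>r\<bar> \<le> 0 * N" by (rule LIMSEQ_le_const) (use bound in auto)
  then show ?thesis by (simp add: r_def \<eta>'_def)
qed

lemma H10_zext:
  assumes D: "open D" and v: "v \<in> H10 D" and E: "open E"
  shows "zext D v \<in> H1 E" "has_weak_gradient E (zext D v) (zext D (wgrad D v))"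
proof -
  note D' = open_lebesgue[OF D]
  note g = has_weak_gradient_wgrad[OF H10_H1[OF v]]
  have L: "zext D v \<in> L2 UNIV" by (rule L2_zext[OF D' H1_L2[OF H10_H1[OF v]]])
  have W: "has_weak_gradient UNIV (zext D v) (zext D (wgrad D v))"
    unfolding has_weak_gradient_def
  proof (intro conjI allI impI)
    fix i
    have "(\<lambda>x. zext D (wgrad D v) x $ i) = zext D (\<lambda>x. wgrad D v x $ i)" by (auto simp: zext_def)
    then show "(\<lambda>x. zext D (wgrad D v) x $ i) \<in> L2 UNIV" using L2_zext[OF D' has_weak_gradient_L2[OF g]] by simp
  next
    fix \<eta> :: "real^'a \<Rightarrow> real" and i assume \<eta>: "test_function UNIV \<eta>"
    have "(LINT x|lebesgue_on UNIV. zext D v x * pd i \<eta> x) = (LINT x|lebesgue_on D. v x * pd i \<eta> x)"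
      by (rule integral_UNIV_eq_lebesgue_on[OF D']) (auto simp: zext_def)
    moreover have "(LINT x|lebesgue_on UNIV. zext D (wgrad D v) x $ i * \<eta> x) = (LINT x|lebesgue_on D. wgrad D v x $ i * \<eta> x)"
      by (rule integral_UNIV_eq_lebesgue_on[OF D']) (auto simp: zext_def)
    ultimately show "(LINT x|lebesgue_on UNIV. zext D v x * pd i \<eta> x) = - (LINT x|lebesgue_on UNIV. zext D (wgrad D v) x $ i * \<eta> x)"
      using H10_integration_by_parts[OF D v \<eta>] by simp
  qed
  show W': "has_weak_gradient E (zext D v) (zext D (wgrad D v))"
    by (rule has_weak_gradient_mono[OF _ open_lebesgue[OF E] _ W]) auto
  show "zext D v \<in> H1 E"
    by (rule H1I[OF L2_mono[OF _ open_lebesgue[OF E] _ L] W']) auto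
qed


section \<open>The bilinear form\<close>

text \<open>The integrability of the form rests on this condition, which restricts from a domain to the
  overlaps inside it.\<close>

definition bounded_coefficients ::
    "(real^'n) set \<Rightarrow> (real^'n \<Rightarrow> real^'n^'n) \<Rightarrow> (real^'n \<Rightarrow> real^'n) \<Rightarrow> (real^'n \<Rightarrow> real) \<Rightarrow> bool" where
  "bounded_coefficients D A b c \<longleftrightarrow>
     A \<in> borel_measurable (lebesgue_on D) \<and> b \<in> borel_measurable (lebesgue_on D) \<and>
     c \<in> borel_measurable (lebesgue_on D) \<and>
     (\<exists>M. AE x in lebesgue_on D. norm (A x) \<le> M \<and> norm (b x) \<le> M \<and> \<bar>c x\<bar> \<le> M)"

lemma bounded_coefficients_mono:
  assumes D: "D \<in> sets lebesgue" "D' \<in> sets lebesgue" "D' \<subseteq> D" and *: "bounded_coefficients D A b c"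
  shows "bounded_coefficients D' A b c"
proof -
  obtain M where M: "AE x in lebesgue_on D. norm (A x) \<le> M \<and> norm (b x) \<le> M \<and> \<bar>c x\<bar> \<le> M"
    and m: "A \<in> borel_measurable (lebesgue_on D)" "b \<in> borel_measurable (lebesgue_on D)" "c \<in> borel_measurable (lebesgue_on D)"
    using * unfolding bounded_coefficients_def by blast
  show ?thesis
    unfolding bounded_coefficients_def
    by (intro conjI exI[of _ M] measurable_restrict_mono[OF _ D(3)] m AE_lebesgue_on_mono[OF D M])
qed

definition bilin_integrand where
  "bilin_integrand A b c u g v h x = (A x *v g x) \<bullet> h x + (b x \<bullet> g x) * v x + c x * u x * v x"

lemma bounded_L2_mult_integrable:
  assumes k: "k \<in> borel_measurable (lebesgue_on D)" "AE x in lebesgue_on D. \<bar>k x\<bar> \<le> M"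
    and uv: "u \<in> L2 D" "v \<in> L2 D"
  shows "integrable (lebesgue_on D) (\<lambda>x. k x * (u x * v x))"
proof (rule Bochner_Integration.integrable_bound)
  show "integrable (lebesgue_on D) (\<lambda>x. M * (u x * v x))"
    by (intro integrable_mult_right L2_mult_integrable uv)
  show "(\<lambda>x. k x * (u x * v x)) \<in> borel_measurable (lebesgue_on D)"
    by (intro borel_measurable_times k L2_borel uv)
  show "AE x in lebesgue_on D. norm (k x * (u x * v x)) \<le> norm (M * (u x * v x))"
    using k(2) by eventually_elim (auto simp: abs_mult intro!: mult_right_mono)
qed

lemma integrable_bilin_integrand:
  assumes C: "bounded_coefficients D A b c" and u: "u \<in> L2 D" and v: "v \<in> L2 D"
    and g: "has_weak_gradient D u g" and h: "has_weak_gradient D v h"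
  shows "integrable (lebesgue_on D) (bilin_integrand A b c u g v h)"
proof -
  obtain M where M: "AE x in lebesgue_on D. norm (A x) \<le> M \<and> norm (b x) \<le> M \<and> \<bar>c x\<bar> \<le> M"
    and m: "A \<in> borel_measurable (lebesgue_on D)" "b \<in> borel_measurable (lebesgue_on D)" "c \<in> borel_measurable (lebesgue_on D)"
    using C unfolding bounded_coefficients_def by blast
  have mA: "(\<lambda>x. A x $ i $ j) \<in> borel_measurable (lebesgue_on D)" for i j
    by (rule measurable_compose[OF m(1)]) (intro borel_measurable_continuous_onI continuous_intros)
  have mb: "(\<lambda>x. b x $ i) \<in> borel_measurable (lebesgue_on D)" for i
    by (rule measurable_compose[OF m(2)]) (intro borel_measurable_continuous_onI continuous_intros)
  have bA: "AE x in lebesgue_on D. \<bar>A x $ i $ j\<bar> \<le> M" for i j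
    using M
  proof eventually_elim
    case (elim x)
    then show ?case
      using component_le_norm_cart[of "A x $ i" j] Finite_Cartesian_Product.norm_nth_le[of "A x" i] by linarith
  qed
  have bb: "AE x in lebesgue_on D. \<bar>b x $ i\<bar> \<le> M" for i
    using M by eventually_elim (meson component_le_norm_cart order_trans)
  have bc: "AE x in lebesgue_on D. \<bar>c x\<bar> \<le> M" using M by eventually_elim simp
  have eq: "bilin_integrand A b c u g v h = (\<lambda>x. (\<Sum>i\<in>UNIV. \<Sum>j\<in>UNIV. A x $ i $ j * (g x $ j * h x $ i)) +
      (\<Sum>i\<in>UNIV. b x $ i * (g x $ i * v x)) + c x * (u x * v x))"
    by (rule ext) (simp add: bilin_integrand_def inner_vec_def matrix_vector_mult_def sum_distrib_right mult.assoc)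
  show ?thesis unfolding eq
    by (intro Bochner_Integration.integrable_add Bochner_Integration.integrable_sum
        bounded_L2_mult_integrable[OF mA bA] bounded_L2_mult_integrable[OF mb bb] bounded_L2_mult_integrable[OF m(3) bc]
        has_weak_gradient_L2[OF g] has_weak_gradient_L2[OF h] u v)
qed

text \<open>Frees the form from the particular representatives chosen by \<^const>\<open>wgrad\<close>. Representatives on
  different domains are chosen independently, so this is what relates forms on different domains.\<close>

lemma bilin_eq:
  assumes D: "open D" and C: "bounded_coefficients D A b c" and u: "u \<in> L2 D" and v: "v \<in> L2 D"
    and g: "has_weak_gradient D u g" and h: "has_weak_gradient D v h"
  shows "bilin A b c D u v = (LINT x|lebesgue_on D. bilin_integrand A b c u g v h x)"
proof -
  have "bilin A b c D u v = (LINT x|lebesgue_on D. bilin_integrand A b c u (wgrad D u) v (wgrad D v) x)"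
    by (simp add: bilin_def bilin_integrand_def)
  also have "\<dots> = (LINT x|lebesgue_on D. bilin_integrand A b c u g v h x)"
  proof (rule integral_cong_AE)
    show "AE x in lebesgue_on D. bilin_integrand A b c u (wgrad D u) v (wgrad D v) x = bilin_integrand A b c u g v h x"
      using wgrad_AE_eq[OF D g] wgrad_AE_eq[OF D h] by eventually_elim (simp add: bilin_integrand_def)
  qed (intro borel_measurable_integrable integrable_bilin_integrand[OF C u v] has_weak_gradient_wgrad H1I g h
        H1I[OF u g] H1I[OF v h])+
  finally show ?thesis .
qed

lemma bilin_lincomb_left:
  assumes D: "open D" and C: "bounded_coefficients D A b c" and u: "u \<in> H1 D" "u' \<in> H1 D" and v: "v \<in> H1 D"
  shows "bilin A b c D (\<lambda>x. s * u x + t * u' x) v = s * bilin A b c D u v + t * bilin A b c D u' v"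
proof -
  note g = u[THEN has_weak_gradient_wgrad] v[THEN has_weak_gradient_wgrad]
  note L = u[THEN H1_L2] v[THEN H1_L2]
  have eq: "bilin_integrand A b c (\<lambda>x. s * u x + t * u' x) (\<lambda>x. s *\<^sub>R wgrad D u x + t *\<^sub>R wgrad D u' x) v (wgrad D v) x =
     s * bilin_integrand A b c u (wgrad D u) v (wgrad D v) x + t * bilin_integrand A b c u' (wgrad D u') v (wgrad D v) x" for x
    by (simp add: bilin_integrand_def matrix_vector_right_distrib matrix_vector_mult_scaleR inner_add_left inner_add_right algebra_simps)
  show ?thesis
    unfolding bilin_eq[OF D C L2_lincomb[OF L(1,2)] L(3) has_weak_gradient_lincomb[OF open_lebesgue[OF D] L(1,2) g(1,2)] g(3)]
      bilin_eq[OF D C L(1,3) g(1,3)] bilin_eq[OF D C L(2,3) g(2,3)] eq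
    using integrable_bilin_integrand[OF C L(1,3) g(1,3)] integrable_bilin_integrand[OF C L(2,3) g(2,3)] by simp
qed

lemma bilin_lincomb_right:
  assumes D: "open D" and C: "bounded_coefficients D A b c" and u: "u \<in> H1 D" "u' \<in> H1 D" and v: "v \<in> H1 D"
  shows "bilin A b c D v (\<lambda>x. s * u x + t * u' x) = s * bilin A b c D v u + t * bilin A b c D v u'"
proof -
  note g = u[THEN has_weak_gradient_wgrad] v[THEN has_weak_gradient_wgrad]
  note L = u[THEN H1_L2] v[THEN H1_L2]
  have eq: "bilin_integrand A b c v (wgrad D v) (\<lambda>x. s * u x + t * u' x) (\<lambda>x. s *\<^sub>R wgrad D u x + t *\<^sub>R wgrad D u' x) x =
     s * bilin_integrand A b c v (wgrad D v) u (wgrad D u) x + t * bilin_integrand A b c v (wgrad D v) u' (wgrad D u') x" for x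
    by (simp add: bilin_integrand_def inner_add_right algebra_simps)
  show ?thesis
    unfolding bilin_eq[OF D C L(3) L2_lincomb[OF L(1,2)] g(3) has_weak_gradient_lincomb[OF open_lebesgue[OF D] L(1,2) g(1,2)]]
      bilin_eq[OF D C L(3,1) g(3,1)] bilin_eq[OF D C L(3,2) g(3,2)] eq
    using integrable_bilin_integrand[OF C L(3,1) g(3,1)] integrable_bilin_integrand[OF C L(3,2) g(3,2)] by simp
qed

lemma bilin_zero_left: 
  assumes D: "open D" and C: "bounded_coefficients D A b c" and v: "v \<in> H1 D"
  shows "bilin A b c D (\<lambda>x. 0) v = 0"
  using bilin_lincomb_left[OF D C H1_zero H1_zero v, of 0 0] by simp

lemma bilin_zero_right:
  assumes D: "open D" and C: "bounded_coefficients D A b c" and v: "v \<in> H1 D"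
  shows "bilin A b c D v (\<lambda>x. 0) = 0"
  using bilin_lincomb_right[OF D C H1_zero H1_zero v, of 0 0] by simp

lemma bilin_sum_left:
  assumes D: "open D" and C: "bounded_coefficients D A b c" and v: "v \<in> H1 D"
  shows "(\<And>k. k \<in> I \<Longrightarrow> w k \<in> H1 D) \<Longrightarrow> bilin A b c D (\<lambda>x. \<Sum>k\<in>I. w k x) v = (\<Sum>k\<in>I. bilin A b c D (w k) v)"
proof (induction I rule: infinite_finite_induct)
  case (insert k I)
  then show ?case
    using bilin_lincomb_left[OF D C _ H1_sum[OF open_lebesgue[OF D]] v, of "w k" I w 1 1] by simp
qed (simp_all add: bilin_zero_left[OF D C v])

lemma bilin_sum_right:
  assumes D: "open D" and C: "bounded_coefficients D A b c" and v: "v \<in> H1 D"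
  shows "(\<And>k. k \<in> I \<Longrightarrow> w k \<in> H1 D) \<Longrightarrow> bilin A b c D v (\<lambda>x. \<Sum>k\<in>I. w k x) = (\<Sum>k\<in>I. bilin A b c D v (w k))"
proof (induction I rule: infinite_finite_induct)
  case (insert k I)
  then show ?case
    using bilin_lincomb_right[OF D C _ H1_sum[OF open_lebesgue[OF D]] v, of "w k" I w 1 1] by simp
qed (simp_all add: bilin_zero_right[OF D C v])

lemma bilin_cong_AE_left:
  assumes D: "open D" and C: "bounded_coefficients D A b c" and u: "u \<in> H1 D" and v: "v \<in> H1 D"
    and ae: "AE x in lebesgue_on D. u x = u' x"
  shows "bilin A b c D u v = bilin A b c D u' v"
proof -
  note g = has_weak_gradient_wgrad[OF u] and h = has_weak_gradient_wgrad[OF v]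
  note D' = open_lebesgue[OF D]
  have g': "has_weak_gradient D u' (wgrad D u)" using has_weak_gradient_cong_AE[OF D' H1_L2[OF u] ae] g by simp
  have u': "u' \<in> L2 D" by (rule L2_cong_AE[OF D' H1_L2[OF u] ae])
  show ?thesis
    unfolding bilin_eq[OF D C H1_L2[OF u] H1_L2[OF v] g h] bilin_eq[OF D C u' H1_L2[OF v] g' h]
  proof (rule integral_cong_AE)
    show "AE x in lebesgue_on D. bilin_integrand A b c u (wgrad D u) v (wgrad D v) x = bilin_integrand A b c u' (wgrad D u) v (wgrad D v) x"
      using ae by eventually_elim (simp add: bilin_integrand_def)
  qed (intro borel_measurable_integrable integrable_bilin_integrand[OF C] H1_L2[OF u] H1_L2[OF v] u' g g' h)+
qed

text \<open>The integrand vanishes off \<open>D\<close>, where both the extension and its weak gradient are \<open>0\<close>.\<close>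

lemma bilin_zext_left:
  assumes D: "open D" and E: "open E" and C: "bounded_coefficients E A b c"
    and v: "v \<in> H10 D" and w: "w \<in> H1 E"
  shows "bilin A b c E (zext D v) w = bilin A b c (D \<inter> E) v w"
proof -
  note D' = open_lebesgue[OF D] and E' = open_lebesgue[OF E]
  have DE: "open (D \<inter> E)" using D E by (rule open_Int)
  note DE' = open_lebesgue[OF DE]
  have sub: "D \<inter> E \<subseteq> E" "D \<inter> E \<subseteq> D" by auto
  note gv = has_weak_gradient_wgrad[OF H10_H1[OF v]] and gw = has_weak_gradient_wgrad[OF w]
  have "bilin A b c E (zext D v) w = (LINT x|lebesgue_on E. bilin_integrand A b c (zext D v) (zext D (wgrad D v)) w (wgrad E w) x)"
    by (rule bilin_eq[OF E C H1_L2[OF H10_zext(1)[OF D v E]] H1_L2[OF w] H10_zext(2)[OF D v E] gw])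
  also have "\<dots> = (LINT x|lebesgue_on (D \<inter> E). bilin_integrand A b c v (wgrad D v) w (wgrad E w) x)"
    unfolding integral_lebesgue_on_if[OF E'] integral_lebesgue_on_if[OF DE']
    by (intro Bochner_Integration.integral_cong) (auto simp: bilin_integrand_def zext_def)
  also have "\<dots> = bilin A b c (D \<inter> E) v w"
    by (rule bilin_eq[symmetric, OF DE bounded_coefficients_mono[OF E' DE' sub(1) C] L2_mono[OF D' DE' sub(2) H1_L2[OF H10_H1[OF v]]]
      L2_mono[OF E' DE' sub(1) H1_L2[OF w]] has_weak_gradient_mono[OF D' DE' sub(2) gv] has_weak_gradient_mono[OF E' DE' sub(1) gw]])
  finally show ?thesis .
qed

section \<open>Additive Schwarz iteration and adjoint representation of the error\<close>

text \<open>A frontier point lies in some element but not in its interior, which is contained in \<open>D\<close>. So the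
  frontier is covered by the frontiers of finitely many convex sets.\<close>

lemma mesh_frontier_null:
  assumes T: "mesh_of T D" and D: "open D" shows "frontier D \<in> null_sets lebesgue"
proof -
  have fin: "finite T" and un: "\<Union>T = closure D" and E: "\<And>E. E \<in> T \<Longrightarrow> int CARD('a) simplex E \<and> interior E \<subseteq> D"
    using T by (auto simp: mesh_of_def triangulation_def)
  have "frontier D \<subseteq> (\<Union>E\<in>T. frontier E)"
  proof
    fix x assume x: "x \<in> frontier D"
    then have "x \<notin> D" "x \<in> \<Union>T" using D un by (auto simp: frontier_def interior_open)
    then obtain F where F: "F \<in> T" "x \<in> F" "x \<notin> interior F" using E by blast
    then show "x \<in> (\<Union>E\<in>T. frontier E)" using closure_subset by (auto simp: frontier_def)
  qed
  moreover have "negligible (frontier E)" if "E \<in> T" for E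
    using E[OF that] convex_simplex negligible_convex_frontier by blast
  then have "negligible (\<Union>E\<in>T. frontier E)" using fin by (intro negligible_Union) auto
  ultimately show ?thesis using negligible_subset negligible_iff_null_sets by blast
qed

text \<open>Off the frontiers, the patched function is \<open>w\<close> plus the zero extension of the local correction, so
  the \<open>p\<close> copies of \<open>\<tau> w\<close> cancel the term \<open>- \<tau> p w\<close>.\<close>

lemma schwarz_update_eq:
  assumes "\<And>i. i \<in> {1..p} \<Longrightarrow> open (\<Omega>s i)" "\<And>i. i \<in> {1..p} \<Longrightarrow> x \<notin> frontier (\<Omega>s i)"
  shows "schwarz_update \<tau> p \<Omega>s w wt x = w x + \<tau> * (\<Sum>i=1..p. zext (\<Omega>s i) (\<lambda>y. wt i y - w y) x)"
proof -
  have "patch (\<Omega>s i) (wt i) w x = w x + zext (\<Omega>s i) (\<lambda>y. wt i y - w y) x" if "i \<in> {1..p}" for i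
    using assms[OF that] closure_subset[of "\<Omega>s i"] by (auto simp: patch_def zext_def frontier_def interior_open)
  then have "(\<Sum>i=1..p. patch (\<Omega>s i) (wt i) w x) = real p * w x + (\<Sum>i=1..p. zext (\<Omega>s i) (\<lambda>y. wt i y - w y) x)"
    by (simp add: sum.distrib)
  then show ?thesis by (simp add: schwarz_update_def algebra_simps)
qed

text \<open>Common to the continuum and the discrete iteration: all that is required of the local solutions is
  that their corrections have zero boundary values.\<close>

lemma schwarz_step:
  assumes \<Omega>: "open \<Omega>" and \<Omega>s: "\<And>i. i \<in> {1..p} \<Longrightarrow> open (\<Omega>s i)"
    and null: "\<And>i. i \<in> {1..p} \<Longrightarrow> frontier (\<Omega>s i) \<in> null_sets lebesgue"
    and w: "w \<in> H1 \<Omega>" and incr: "\<And>i. i \<in> {1..p} \<Longrightarrow> (\<lambda>x. wt i x - w x) \<in> H10 (\<Omega>s i)"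
    and step: "AE x in lebesgue_on \<Omega>. w' x = schwarz_update \<tau> p \<Omega>s w wt x"
  shows "w' \<in> H1 \<Omega>"
    and "AE x in lebesgue_on \<Omega>. w' x = w x + \<tau> * (\<Sum>i=1..p. zext (\<Omega>s i) (\<lambda>y. wt i y - w y) x)"
proof -
  note \<Omega>' = open_lebesgue[OF \<Omega>]
  have "AE x in lebesgue. \<forall>i\<in>{1..p}. x \<notin> frontier (\<Omega>s i)"
    by (subst AE_ball_countable) (auto intro!: AE_not_in null)
  then have "AE x in lebesgue_on \<Omega>. \<forall>i\<in>{1..p}. x \<notin> frontier (\<Omega>s i)"
    unfolding AE_lebesgue_on_iff[OF \<Omega>'] by (auto elim!: eventually_mono)
  with step show ae: "AE x in lebesgue_on \<Omega>. w' x = w x + \<tau> * (\<Sum>i=1..p. zext (\<Omega>s i) (\<lambda>y. wt i y - w y) x)"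
  proof eventually_elim
    case (elim x)
    have "schwarz_update \<tau> p \<Omega>s w wt x = w x + \<tau> * (\<Sum>i=1..p. zext (\<Omega>s i) (\<lambda>y. wt i y - w y) x)"
      by (rule schwarz_update_eq) (use \<Omega>s elim(2) in blast)+
    then show ?case using elim(1) by simp
  qed
  have "(\<lambda>x. \<Sum>i=1..p. zext (\<Omega>s i) (\<lambda>y. wt i y - w y) x) \<in> H1 \<Omega>"
    by (intro H1_sum[OF \<Omega>'] H10_zext(1)[OF \<Omega>s incr \<Omega>])
  then have "(\<lambda>x. 1 * w x + \<tau> * (\<Sum>i=1..p. zext (\<Omega>s i) (\<lambda>y. wt i y - w y) x)) \<in> H1 \<Omega>"
    by (intro H1_lincomb[OF \<Omega>' w])
  then show "w' \<in> H1 \<Omega>"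
    by (rule H1_cong_AE[OF \<Omega>']) (use ae in \<open>auto elim!: eventually_mono\<close>)
qed

lemma l2inner_zext:
  assumes D: "D \<in> sets lebesgue" and E: "E \<in> sets lebesgue" and sub: "D \<subseteq> E"
  shows "l2inner E \<psi> (zext D v) = l2inner D \<psi> v"
  unfolding l2inner_def integral_lebesgue_on_if[OF D] integral_lebesgue_on_if[OF E]
  by (intro Bochner_Integration.integral_cong) (use sub in \<open>auto simp: zext_def\<close>)

lemma l2inner_cong_AE:
  assumes D: "D \<in> sets lebesgue" and L: "\<psi> \<in> L2 D" "u \<in> L2 D" and ae: "AE x in lebesgue_on D. u x = v x"
  shows "l2inner D \<psi> u = l2inner D \<psi> v"
  unfolding l2inner_def
  by (intro integral_cong_AE borel_measurable_times L2_borel L L2_cong_AE[OF D L(2) ae]) (use ae in auto)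

lemma l2inner_scale: "l2inner D \<psi> (\<lambda>x. t * v x) = t * l2inner D \<psi> v"
  unfolding l2inner_def by (subst integral_mult_right_zero[symmetric]) (simp add: ac_simps)

lemma l2inner_sum:
  assumes "\<psi> \<in> L2 D" "\<And>k. k \<in> I \<Longrightarrow> v k \<in> L2 D"
  shows "l2inner D \<psi> (\<lambda>x. \<Sum>k\<in>I. v k x) = (\<Sum>k\<in>I. l2inner D \<psi> (v k))"
  unfolding l2inner_def sum_distrib_left using assms
  by (intro Bochner_Integration.integral_sum L2_mult_integrable)

lemma l2inner_diff:
  assumes "\<psi> \<in> L2 D" "u \<in> L2 D" "v \<in> L2 D"
  shows "l2inner D \<psi> (\<lambda>x. u x - v x) = l2inner D \<psi> u - l2inner D \<psi> v"
  unfolding l2inner_def using L2_mult_integrable[OF assms(1,2)] L2_mult_integrable[OF assms(1,3)]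
  by (simp add: right_diff_distrib)

text \<open>Each \<open>\<psi>s j\<close> vanishes off \<open>\<Omega>s j\<close>, so every term may be integrated over all of \<open>D\<close>, where the
  weights add up to \<open>1\<close>.\<close>

lemma l2inner_partition:
  assumes D: "open D" "D \<subseteq> \<Omega>" and \<Omega>: "open \<Omega>" and \<Omega>s: "\<And>i. i \<in> {1..p} \<Longrightarrow> open (\<Omega>s i)"
    and \<rho>: "data_partition \<Omega> p \<Omega>s \<rho>" and \<psi>s: "\<forall>i\<in>{1..p}. \<forall>x\<in>\<Omega>. \<psi>s i x = \<rho> i x * \<psi> x"
    and \<psi>: "\<psi> \<in> L2 \<Omega>" and v: "v \<in> L2 D"
  shows "(\<Sum>j=1..p. l2inner (D \<inter> \<Omega>s j) (\<psi>s j) v) = l2inner D \<psi> v"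
proof -
  note D' = open_lebesgue[OF D(1)] and \<Omega>' = open_lebesgue[OF \<Omega>]
  have \<psi>D: "\<psi> \<in> L2 D" by (rule L2_mono[OF \<Omega>' D' D(2) \<psi>])
  have nn: "0 \<le> \<rho> j x" if "j \<in> {1..p}" "x \<in> \<Omega>" for j x using \<rho> that unfolding data_partition_def by blast
  have sum1: "(\<Sum>j=1..p. \<rho> j x) = 1" if "x \<in> \<Omega>" for x using \<rho> that unfolding data_partition_def by blast
  have int: "integrable (lebesgue_on D) (\<lambda>x. \<rho> j x * (\<psi> x * v x))" if j: "j \<in> {1..p}" for j
  proof (rule bounded_L2_mult_integrable[OF _ _ \<psi>D v])
    show "\<rho> j \<in> borel_measurable (lebesgue_on D)"
      using \<rho> j measurable_restrict_mono[OF _ D(2)] unfolding data_partition_def by blast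
    have "\<rho> j x \<le> 1" if "x \<in> \<Omega>" for x
      using member_le_sum[of j "{1..p}" "\<lambda>j. \<rho> j x"] j nn[OF _ that] sum1[OF that] by auto
    then show "AE x in lebesgue_on D. \<bar>\<rho> j x\<bar> \<le> 1"
      using nn[OF j] D(2) by (intro AE_I2) auto
  qed
  have "l2inner (D \<inter> \<Omega>s j) (\<psi>s j) v = (LINT x|lebesgue_on D. \<rho> j x * (\<psi> x * v x))" if j: "j \<in> {1..p}" for j
  proof -
    have 0: "\<rho> j x = 0" if "x \<in> \<Omega> - \<Omega>s j" for x using \<rho> j that unfolding data_partition_def by blast
    have "D \<inter> \<Omega>s j \<in> sets lebesgue" using D(1) \<Omega>s[OF j] by (intro open_lebesgue) auto
    then show ?thesis
      unfolding l2inner_def using D(2) 0 \<psi>s j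
      by (simp only: integral_lebesgue_on_if[OF D'] integral_lebesgue_on_if) (intro Bochner_Integration.integral_cong, auto)
  qed
  then have "(\<Sum>j=1..p. l2inner (D \<inter> \<Omega>s j) (\<psi>s j) v) = (LINT x|lebesgue_on D. (\<Sum>j=1..p. \<rho> j x * (\<psi> x * v x)))"
    using int by simp
  also have "\<dots> = l2inner D \<psi> v"
    unfolding l2inner_def sum_distrib_right[symmetric] using sum1 D(2)
    by (intro Bochner_Integration.integral_cong) auto
  finally show ?thesis .
qed

lemma sum_triangle_swap:
  fixes S :: "nat \<Rightarrow> nat \<Rightarrow> 'a::comm_monoid_add"
  shows "(\<Sum>k=1..K. \<Sum>m=1..<k. S m k) = (\<Sum>m=1..K. \<Sum>l=m+1..K. S m l)"
proof (induction K)
  case (Suc K)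
  have "(\<Sum>m=1..Suc K. \<Sum>l=m+1..Suc K. S m l) = (\<Sum>m=1..K. \<Sum>l=m+1..Suc K. S m l)" by simp
  also have "\<dots> = (\<Sum>m=1..K. (\<Sum>l=m+1..K. S m l) + S m (Suc K))"
    by (intro sum.cong) auto
  finally show ?case using Suc by (simp add: sum.distrib atLeastLessThanSuc_atLeastAtMost)
qed simp

theorem theorem4:
  fixes \<Omega> :: "(real^'n) set" and p :: nat and \<Omega>s :: "nat \<Rightarrow> (real^'n) set"
    and A :: "real^'n \<Rightarrow> real^'n^'n" and b :: "real^'n \<Rightarrow> real^'n" and c f \<psi> :: "real^'n \<Rightarrow> real"
    and T :: "(real^'n) set set" and q K :: nat and \<tau> :: real
    and u U :: "nat \<Rightarrow> real^'n \<Rightarrow> real" and ut Ut \<phi> :: "nat \<Rightarrow> nat \<Rightarrow> real^'n \<Rightarrow> real"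
    and \<rho> \<psi>s :: "nat \<Rightarrow> real^'n \<Rightarrow> real"
    and \<pi> :: "nat \<Rightarrow> (real^'n \<Rightarrow> real) \<Rightarrow> (real^'n \<Rightarrow> real)"
  assumes "overlapping_decomposition \<Omega> p \<Omega>s"
    and "elliptic_coefficients \<Omega> A b c"
    and "f \<in> L2 \<Omega>" and "\<psi> \<in> L2 \<Omega>"
    and "mesh_of T \<Omega>"
    and "\<forall>i\<in>{1..p}. mesh_of (restrict_mesh T (\<Omega>s i)) (\<Omega>s i)"
    and "K \<ge> 1"
    and "U 0 \<in> fe_space0 T q \<Omega>"
    and "AE x in lebesgue_on \<Omega>. u 0 x = U 0 x"
    and "continuum_schwarz A b c f \<Omega> p \<Omega>s \<tau> K u ut"
    and "discrete_schwarz A b c f T q \<Omega> p \<Omega>s \<tau> K U Ut"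
    and "data_partition \<Omega> p \<Omega>s \<rho>"
    and "\<forall>i\<in>{1..p}. \<forall>x\<in>\<Omega>. \<psi>s i x = \<rho> i x * \<psi> x"
    and "\<forall>k\<in>{1..K}. \<forall>i\<in>{1..p}.
           solves_uniquely (\<Omega>s i) (adjoint_problem A b c p \<Omega>s \<tau> K \<psi>s \<phi> k i) (\<phi> k i)"
    and "\<forall>i\<in>{1..p}. \<forall>v\<in>H10 (\<Omega>s i). \<pi> i v \<in> fe_space0 T q (\<Omega>s i)"
  shows "l2inner \<Omega> \<psi> (\<lambda>x. u K x - U K x) =
         (\<Sum>k=1..K. \<Sum>i=1..p.
            resid A b c f (\<Omega>s i) (Ut k i) (\<lambda>x. \<phi> k i x - \<pi> i (\<phi> k i) x))"
proof -
  have \<Omega>: "open \<Omega>" and \<Omega>s: "\<And>i. i \<in> {1..p} \<Longrightarrow> open (\<Omega>s i)" and sub: "\<And>i. i \<in> {1..p} \<Longrightarrow> \<Omega>s i \<subseteq> \<Omega>"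
    using assms(1) by (auto simp: overlapping_decomposition_def)
  note \<Omega>' = open_lebesgue[OF \<Omega>] and \<Omega>s' = open_lebesgue[OF \<Omega>s]
  have null: "frontier (\<Omega>s i) \<in> null_sets lebesgue" if "i \<in> {1..p}" for i
    using mesh_frontier_null \<Omega>s[OF that] assms(6) that by blast
  have C: "bounded_coefficients \<Omega> A b c"
    using assms(2) unfolding elliptic_coefficients_def bounded_coefficients_def by blast
  have Cs: "bounded_coefficients (\<Omega>s i) A b c" if "i \<in> {1..p}" for i
    by (rule bounded_coefficients_mono[OF \<Omega>' \<Omega>s'[OF that] sub[OF that] C])

  have loc: "local_problem A b c f (\<Omega>s i) (u k) (ut (Suc k) i)"
    and dloc: "discrete_local_problem A b c f T q (\<Omega>s i) (U k) (Ut (Suc k) i)" if "k < K" "i \<in> {1..p}" for k i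
    using assms(10,11) that unfolding continuum_schwarz_def discrete_schwarz_def solves_uniquely_def by blast+
  have upd: "AE x in lebesgue_on \<Omega>. u (Suc k) x = schwarz_update \<tau> p \<Omega>s (u k) (ut (Suc k)) x"
    and Upd: "AE x in lebesgue_on \<Omega>. U (Suc k) x = schwarz_update \<tau> p \<Omega>s (U k) (Ut (Suc k)) x" if "k < K" for k
  proof -
    show "AE x in lebesgue_on \<Omega>. u (Suc k) x = schwarz_update \<tau> p \<Omega>s (u k) (ut (Suc k)) x"
      using assms(10) that unfolding continuum_schwarz_def by blast
    have "\<forall>x\<in>closure \<Omega>. U (Suc k) x = schwarz_update \<tau> p \<Omega>s (U k) (Ut (Suc k)) x"
      using assms(11) that unfolding discrete_schwarz_def by blast
    then show "AE x in lebesgue_on \<Omega>. U (Suc k) x = schwarz_update \<tau> p \<Omega>s (U k) (Ut (Suc k)) x"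
      using closure_subset by (intro AE_I2) auto
  qed
  have incr: "(\<lambda>x. ut (Suc k) i x - u k x) \<in> H10 (\<Omega>s i)"
    and Incr: "(\<lambda>x. Ut (Suc k) i x - U k x) \<in> H10 (\<Omega>s i)" if "k < K" "i \<in> {1..p}" for k i
    using loc[OF that] dloc[OF that] by (auto simp: local_problem_def discrete_local_problem_def fe_space0_def)

  have U1: "U k \<in> H1 \<Omega>" if "k \<le> K" for k
    using that
  proof (induction k)
    case 0
    show ?case using assms(8) by (auto simp: fe_space0_def H10_def)
  next
    case (Suc k)
    then show ?case using schwarz_step(1)[OF \<Omega> \<Omega>s null _ Incr Upd] by simp
  qed
  have u1: "u k \<in> H1 \<Omega>" if "k \<le> K" for k
    using that
  proof (induction k)
    case 0
    have "AE x in lebesgue_on \<Omega>. U 0 x = u 0 x" using assms(9) by eventually_elim simp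
    then show ?case using H1_cong_AE[OF \<Omega>' U1[of 0]] by simp
  next
    case (Suc k)
    then show ?case using schwarz_step(1)[OF \<Omega> \<Omega>s null _ incr upd] by simp
  qed

  \<comment> \<open>The local solutions with index \<open>k\<close> start from the global iterates with index \<open>k - 1\<close>;
      only \<open>k \<ge> 1\<close> occurs.\<close>
  define z where "z k i = (\<lambda>x. (ut k i x - u (k - 1) x) - (Ut k i x - U (k - 1) x))" for k i
  have z: "z k i \<in> H10 (\<Omega>s i)" if k: "k \<in> {1..K}" and i: "i \<in> {1..p}" for k i
  proof -
    obtain k' where "k = Suc k'" "k' < K" using k by (cases k) auto
    then show ?thesis unfolding z_def using H10_diff[OF \<Omega>s incr Incr] i by simp
  qed
  \<comment> \<open>Up to the factor \<open>\<tau>\<close>, the error just before sweep \<open>k\<close>, which explains the open upper end of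
      the range and the successor in the next fact.\<close>
  define e where "e k x = (\<Sum>m=1..<k. \<Sum>j=1..p. zext (\<Omega>s j) (z m j) x)" for k x
  have err: "AE x in lebesgue_on \<Omega>. \<tau> * e (Suc k) x = u k x - U k x" if "k \<le> K" for k
    using that
  proof (induction k)
    case 0
    show ?case using assms(9) by eventually_elim (simp add: e_def)
  next
    case (Suc k)
    have "AE x in lebesgue_on \<Omega>. u (Suc k) x = u k x + \<tau> * (\<Sum>i=1..p. zext (\<Omega>s i) (\<lambda>y. ut (Suc k) i y - u k y) x)"
      using Suc.prems by (intro schwarz_step(2)[OF \<Omega> \<Omega>s null u1 incr upd]) auto
    moreover have "AE x in lebesgue_on \<Omega>. U (Suc k) x = U k x + \<tau> * (\<Sum>i=1..p. zext (\<Omega>s i) (\<lambda>y. Ut (Suc k) i y - U k y) x)"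
      using Suc.prems by (intro schwarz_step(2)[OF \<Omega> \<Omega>s null U1 Incr Upd]) auto
    moreover have "AE x in lebesgue_on \<Omega>. \<tau> * e (Suc k) x = u k x - U k x" using Suc by simp
    ultimately show ?case
    proof eventually_elim
      case (elim x)
      have "zext (\<Omega>s i) (z (Suc k) i) x = zext (\<Omega>s i) (\<lambda>y. ut (Suc k) i y - u k y) x - zext (\<Omega>s i) (\<lambda>y. Ut (Suc k) i y - U k y) x" for i
        by (simp add: zext_def z_def)
      then have eS: "e (Suc (Suc k)) x = e (Suc k) x + ((\<Sum>i=1..p. zext (\<Omega>s i) (\<lambda>y. ut (Suc k) i y - u k y) x) - (\<Sum>i=1..p. zext (\<Omega>s i) (\<lambda>y. Ut (Suc k) i y - U k y) x))"
        by (simp add: e_def sum_subtractf)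
      show ?case
        using elim unfolding eS distrib_left right_diff_distrib by linarith
    qed
  qed

  have adj: "adjoint_problem A b c p \<Omega>s \<tau> K \<psi>s \<phi> k i (\<phi> k i)" if "k \<in> {1..K}" "i \<in> {1..p}" for k i
    using assms(14) that unfolding solves_uniquely_def by blast
  then have \<phi>: "\<phi> k i \<in> H10 (\<Omega>s i)" if "k \<in> {1..K}" "i \<in> {1..p}" for k i
    using that unfolding adjoint_problem_def by blast
  define B where "B m j l i = bilin A b c (\<Omega>s j \<inter> \<Omega>s i) (z m j) (\<phi> l i)" for m j l i
  define L where "L k i = l2inner \<Omega> \<psi> (zext (\<Omega>s i) (z k i))" for k i

  have zext1: "zext (\<Omega>s j) (z m j) \<in> H1 E" if "m \<in> {1..K}" "j \<in> {1..p}" "open E" for m j E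
    by (rule H10_zext(1)[OF \<Omega>s z]) (use that in auto)

  \<comment> \<open>Galerkin orthogonality, the continuum local problem, and the splitting of the local error into
      the inherited error and the new correction error.\<close>
  have res: "resid A b c f (\<Omega>s i) (Ut k i) (\<lambda>x. \<phi> k i x - \<pi> i (\<phi> k i) x) =
      \<tau> * (\<Sum>m=1..<k. \<Sum>j=1..p. B m j k i) + bilin A b c (\<Omega>s i) (z k i) (\<phi> k i)"
    if k: "k \<in> {1..K}" and i: "i \<in> {1..p}" for k i
  proof -
    obtain k' where k': "k = Suc k'" "k' < K" using k by (cases k) auto
    let ?D = "\<Omega>s i" and ?a = "bilin A b c (\<Omega>s i)" and ?\<phi> = "\<phi> k i" and ?\<pi> = "\<pi> i (\<phi> k i)"
    note D = \<Omega>s[OF i] and D' = \<Omega>s'[OF i] and CD = Cs[OF i]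
    have \<phi>1: "?\<phi> \<in> H1 ?D" and \<pi>0: "?\<pi> \<in> fe_space0 T q ?D"
      using \<phi>[OF k i] assms(15) i H10_H1 by blast+
    then have \<pi>1: "?\<pi> \<in> H1 ?D" using H10_H1 by (auto simp: fe_space0_def)
    have fD: "f \<in> L2 ?D" by (rule L2_mono[OF \<Omega>' D' sub[OF i] assms(3)])
    have uD: "u k' \<in> H1 ?D" "U k' \<in> H1 ?D"
      using u1 U1 k'(2) by (auto intro: H1_mono[OF \<Omega>' D' sub[OF i]])
    have ut1: "ut k i \<in> H1 ?D" using loc[OF k'(2) i] unfolding local_problem_def k'(1) by blast
    have "(\<lambda>x. (Ut k i x - U k' x) + U k' x) \<in> H1 ?D"
      using H10_H1[OF Incr[OF k'(2) i]] uD(2) unfolding k'(1) by (rule H1_add[OF D'])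
    then have Ut1: "Ut k i \<in> H1 ?D" by simp
    have eD: "e k \<in> H1 ?D" unfolding e_def
      using k by (intro H1_sum[OF D'] zext1 D) auto
    have e\<tau>: "(\<lambda>x. \<tau> * e k x) \<in> H1 ?D" using H1_lincomb[OF D' eD H1_zero, of \<tau> 0] by simp
    have z1: "z k i \<in> H1 ?D" by (rule H10_H1[OF z[OF k i]])
    have "resid A b c f ?D (Ut k i) (\<lambda>x. ?\<phi> x - ?\<pi> x) =
        (l2inner ?D f ?\<phi> - ?a (Ut k i) ?\<phi>) - (l2inner ?D f ?\<pi> - ?a (Ut k i) ?\<pi>)"
      using bilin_lincomb_right[OF D CD \<phi>1 \<pi>1 Ut1, of 1 "-1"] l2inner_diff[OF fD H1_L2[OF \<phi>1] H1_L2[OF \<pi>1]]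
      by (simp add: resid_def)
    also have "l2inner ?D f ?\<pi> - ?a (Ut k i) ?\<pi> = 0"
      using dloc[OF k'(2) i] \<pi>0 unfolding discrete_local_problem_def k'(1) by auto
    also have "l2inner ?D f ?\<phi> = ?a (ut k i) ?\<phi>"
      using loc[OF k'(2) i] \<phi>[OF k i] unfolding local_problem_def k'(1) by auto
    also have "?a (ut k i) ?\<phi> - ?a (Ut k i) ?\<phi> - 0 = ?a (\<lambda>x. 1 * ut k i x + (-1) * Ut k i x) ?\<phi>"
      using bilin_lincomb_left[OF D CD ut1 Ut1 \<phi>1, of 1 "-1"] by simp
    also have "\<dots> = ?a (\<lambda>x. \<tau> * e k x + 1 * z k i x) ?\<phi>"
    proof (rule bilin_cong_AE_left[OF D CD H1_lincomb[OF D' ut1 Ut1] \<phi>1])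
      have "AE x in lebesgue_on ?D. \<tau> * e k x = u k' x - U k' x"
        using err[of k'] k' by (intro AE_lebesgue_on_mono[OF \<Omega>' D' sub[OF i]]) auto
      then show "AE x in lebesgue_on ?D. 1 * ut k i x + (-1) * Ut k i x = \<tau> * e k x + 1 * z k i x"
        by eventually_elim (simp add: z_def k'(1))
    qed
    also have "\<dots> = \<tau> * ?a (e k) ?\<phi> + ?a (z k i) ?\<phi>"
      using bilin_lincomb_left[OF D CD eD z1 \<phi>1, of \<tau> 1] by simp
    also have "?a (e k) ?\<phi> = (\<Sum>m=1..<k. \<Sum>j=1..p. ?a (zext (\<Omega>s j) (z m j)) ?\<phi>)"
    proof -
      have "?a (e k) ?\<phi> = (\<Sum>m=1..<k. ?a (\<lambda>x. \<Sum>j=1..p. zext (\<Omega>s j) (z m j) x) ?\<phi>)"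
        unfolding e_def using k by (intro bilin_sum_left[OF D CD \<phi>1] H1_sum[OF D'] zext1 D) auto
      also have "\<dots> = (\<Sum>m=1..<k. \<Sum>j=1..p. ?a (zext (\<Omega>s j) (z m j)) ?\<phi>)"
        using k by (intro sum.cong refl bilin_sum_left[OF D CD \<phi>1] zext1 D) auto
      finally show ?thesis .
    qed
    also have "\<dots> = (\<Sum>m=1..<k. \<Sum>j=1..p. B m j k i)"
      unfolding B_def using k by (intro sum.cong refl bilin_zext_left[OF \<Omega>s D CD z \<phi>1]) auto
    finally show ?thesis .
  qed

  \<comment> \<open>The adjoint problem tested with the correction error.\<close>
  have loc_adj: "bilin A b c (\<Omega>s i) (z k i) (\<phi> k i) =
      \<tau> * (L k i - (\<Sum>j=1..p. \<Sum>l=k+1..K. B k i l j))" if k: "k \<in> {1..K}" and i: "i \<in> {1..p}" for k i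
  proof -
    have "bilin A b c (\<Omega>s i \<inter> \<Omega>s j) (z k i) (\<lambda>x. \<Sum>l=k+1..K. \<phi> l j x) = (\<Sum>l=k+1..K. B k i l j)"
      if j: "j \<in> {1..p}" for j
      unfolding B_def
    proof (rule bilin_sum_right)
      show E: "open (\<Omega>s i \<inter> \<Omega>s j)" using \<Omega>s i j by auto
      note E' = open_lebesgue[OF E]
      show "bounded_coefficients (\<Omega>s i \<inter> \<Omega>s j) A b c"
        by (rule bounded_coefficients_mono[OF \<Omega>s'[OF i] E' _ Cs[OF i]]) auto
      show "z k i \<in> H1 (\<Omega>s i \<inter> \<Omega>s j)"
        by (rule H1_mono[OF \<Omega>s'[OF i] E' _ H10_H1[OF z[OF k i]]]) auto
      show "\<phi> l j \<in> H1 (\<Omega>s i \<inter> \<Omega>s j)" if "l \<in> {k+1..K}" for l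
        by (rule H1_mono[OF \<Omega>s'[OF j] E' _ H10_H1[OF \<phi>[OF _ j]]]) (use k that in auto)
    qed
    moreover have "(\<Sum>j=1..p. l2inner (\<Omega>s i \<inter> \<Omega>s j) (\<psi>s j) (z k i)) = L k i"
      unfolding L_def l2inner_zext[OF \<Omega>s'[OF i] \<Omega>' sub[OF i]]
      by (rule l2inner_partition[OF \<Omega>s[OF i] sub[OF i] \<Omega> \<Omega>s assms(12,13,4) H1_L2[OF H10_H1[OF z[OF k i]]]]) auto
    ultimately show ?thesis
      using adj[OF k i] z[OF k i] unfolding adjoint_problem_def by (simp add: sum_subtractf)
  qed

  \<comment> \<open>Pairs of an earlier sweep (correction error) and a later sweep (adjoint solution), listed once by
      the later and once by the earlier sweep.\<close>
  have swap: "(\<Sum>k=1..K. \<Sum>i=1..p. \<Sum>m=1..<k. \<Sum>j=1..p. B m j k i) = (\<Sum>k=1..K. \<Sum>i=1..p. \<Sum>j=1..p. \<Sum>l=k+1..K. B k i l j)"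
  proof -
    have "(\<Sum>k=1..K. \<Sum>i=1..p. \<Sum>m=1..<k. \<Sum>j=1..p. B m j k i) = (\<Sum>k=1..K. \<Sum>m=1..<k. \<Sum>i=1..p. \<Sum>j=1..p. B m j k i)"
      by (intro sum.cong refl sum.swap)
    also have "\<dots> = (\<Sum>m=1..K. \<Sum>l=m+1..K. \<Sum>i=1..p. \<Sum>j=1..p. B m j l i)" by (rule sum_triangle_swap)
    also have "\<dots> = (\<Sum>m=1..K. \<Sum>l=m+1..K. \<Sum>j=1..p. \<Sum>i=1..p. B m j l i)"
      by (intro sum.cong refl sum.swap)
    also have "\<dots> = (\<Sum>m=1..K. \<Sum>j=1..p. \<Sum>l=m+1..K. \<Sum>i=1..p. B m j l i)"
      by (intro sum.cong refl sum.swap)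
    also have "\<dots> = (\<Sum>m=1..K. \<Sum>j=1..p. \<Sum>i=1..p. \<Sum>l=m+1..K. B m j l i)"
      by (intro sum.cong refl sum.swap)
    finally show ?thesis .
  qed

  have "l2inner \<Omega> \<psi> (\<lambda>x. u K x - U K x) = l2inner \<Omega> \<psi> (\<lambda>x. \<tau> * e (Suc K) x)"
  proof (rule l2inner_cong_AE[OF \<Omega>' assms(4), symmetric])
    have "e (Suc K) \<in> H1 \<Omega>" unfolding e_def by (intro H1_sum[OF \<Omega>'] zext1 \<Omega>) auto
    then show "(\<lambda>x. \<tau> * e (Suc K) x) \<in> L2 \<Omega>" by (intro L2_scale H1_L2)
    show "AE x in lebesgue_on \<Omega>. \<tau> * e (Suc K) x = u K x - U K x" by (rule err) simp
  qed
  also have "\<dots> = \<tau> * (\<Sum>k=1..K. \<Sum>i=1..p. L k i)"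
  proof -
    have "l2inner \<Omega> \<psi> (e (Suc K)) = (\<Sum>k=1..<Suc K. l2inner \<Omega> \<psi> (\<lambda>x. \<Sum>i=1..p. zext (\<Omega>s i) (z k i) x))"
      unfolding e_def by (intro l2inner_sum assms(4) H1_L2 H1_sum[OF \<Omega>'] zext1 \<Omega>) auto
    also have "\<dots> = (\<Sum>k=1..<Suc K. \<Sum>i=1..p. L k i)"
      unfolding L_def by (intro sum.cong refl l2inner_sum assms(4) H1_L2 zext1 \<Omega>) auto
    finally show ?thesis by (simp add: l2inner_scale atLeastLessThanSuc_atLeastAtMost)
  qed
  also have "\<dots> = (\<Sum>k=1..K. \<Sum>i=1..p. \<tau> * (\<Sum>m=1..<k. \<Sum>j=1..p. B m j k i) + \<tau> * (L k i - (\<Sum>j=1..p. \<Sum>l=k+1..K. B k i l j)))"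
    using swap by (simp add: sum.distrib sum_subtractf sum_distrib_left[symmetric] right_diff_distrib)
  also have "\<dots> = (\<Sum>k=1..K. \<Sum>i=1..p. resid A b c f (\<Omega>s i) (Ut k i) (\<lambda>x. \<phi> k i x - \<pi> i (\<phi> k i) x))"
    by (intro sum.cong refl) (simp add: res loc_adj)
  finally show ?thesis .
qed

end
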